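(* Let $\theta\in(-1,1)$ and let $(X_n)_{n\in\mathbb{N}}$ be the centered stationary Gaussian AR(1) process with parameter $\theta$. For $n\in\mathbb{N}$ let $$\boldsymbol{S}_n=\frac1n\left(\sum_{k=1}^nX_k,\ \sum_{k=1}^nX_k^2\right).$$ Then $(\boldsymbol{S}_n)_{n\in\mathbb{N}}$ satisfies a large deviation principle (with speed $n$) in $\mathbb{R}^2$ with good rate function $$J_{\boldsymbol{S}}(x,y)=\begin{cases}\frac12\left[y(1+\theta^2)-2x^2\theta-\sqrt{1+4\theta^2(y-x^2)^2}-\log\left(\frac{2(y-x^2)}{1+\sqrt{1+4\theta^2(y-x^2)^2}}\right)\right], & \text{if } y>x^2,\\ \infty, & \text{if } y\leq x^2.\end{cases}$$
   Context: The centered stationary Gaussian AR(1) process with parameter $\theta$, $|\theta|<1$, is defined by $X_{n+1}=\theta X_n+\varepsilon_{n+1}$ for $n\in\mathbb{N}=\{1,2,\dots\}$, where $(\varepsilon_n)_{n\geq2}$ are i.i.d. $\mathcal{N}(0,1)$ random variables and $X_1\sim\mathcal{N}(0,1/(1-\theta^2))$ is independent of $(\varepsilon_n)_{n\geq 2}$. A sequence of random vectors $(\boldsymbol{V}_n)$ of $\mathbb{R}^d$ satisfies a large deviation principle (LDP) with speed $n$ and rate function $J$ if $J:\mathbb{R}^d\to[0,\infty]$ is lower semicontinuous and (i) for every closed $F\subset\mathbb{R}^d$, $\limsup_{n\to\infty}\frac1n\log\mathbb{P}(\boldsymbol{V}_n\in F)\leq-\inf_{\boldsymbol{x}\in F}J(\boldsymbol{x})$;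 (ii) for every open $G\subset\mathbb{R}^d$, $-\inf_{\boldsymbol{x}\in G}J(\boldsymbol{x})\leq\liminf_{n\to\infty}\frac1n\log\mathbb{P}(\boldsymbol{V}_n\in G)$. The rate function is good if its level sets $J^{-1}([0,b])$ are compact for all $b\in\mathbb{R}$. *)

theory Defs
  imports "HOL-Probability.Probability"
begin

locale stationary_AR1 = prob_space M for M :: "'w measure" +
  fixes \<theta> :: real and X \<epsilon> :: "nat \<Rightarrow> 'w \<Rightarrow> real"
  assumes abs_theta_less_1: "\<bar>\<theta>\<bar> < 1"
    and innovations_indep: "indep_vars (\<lambda>_. borel) \<epsilon> {2..}"
    and innovations_distr: "\<And>n. n \<ge> 2 \<Longrightarrow> distributed M lborel (\<epsilon> n) (normal_density 0 1)"
    \<comment> \<open>the second parameter of \<^const>\<open>normal_density\<close> is the standard deviation\<close>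
    and initial_distr: "distributed M lborel (X 1) (normal_density 0 (sqrt (1 / (1 - \<theta>\<^sup>2))))"
    \<comment> \<open>independence of \<open>X 1\<close> and the whole sequence \<open>(\<epsilon> n)\<close>, \<open>n \<ge> 2\<close>, through the generated
      sigma-algebras: \<^const>\<open>indep_var\<close> needs both variables to have the same value type\<close>
    and initial_indep: "indep_set
          (sets (vimage_algebra (space M) (X 1) borel))
          (sets (vimage_algebra (space M) (\<lambda>\<omega>. \<lambda>n\<in>{2..}. \<epsilon> n \<omega>)
                  (\<Pi>\<^sub>M n\<in>{2::nat..}. (borel :: real measure))))"
    and recursion: "\<And>n \<omega>. n \<ge> 1 \<Longrightarrow> \<omega> \<in> space M \<Longrightarrow> X (n + 1) \<omega> = \<theta> * X n \<omega> + \<epsilon> (n + 1) \<omega>"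

text \<open>Logarithm of a probability, with \<open>log 0 = -\<infinity>\<close> (whereas \<open>ln 0 = 0\<close> on the reals).\<close>

definition log_prob :: "real \<Rightarrow> ereal" where
  "log_prob p = (if p = 0 then -\<infinity> else ereal (ln p))"

definition lower_semicontinuous :: "('a::topological_space \<Rightarrow> ereal) \<Rightarrow> bool" where
  "lower_semicontinuous J \<longleftrightarrow> (\<forall>x. J x \<le> Liminf (nhds x) J)"

text \<open>Large deviation principle with speed \<open>n\<close>. Sequences are indexed by the positive integers;
  the value of \<open>V\<close> at \<open>0\<close> plays no role.\<close>

definition satisfies_LDP ::
  "'w measure \<Rightarrow> (nat \<Rightarrow> 'w \<Rightarrow> 'a::euclidean_space) \<Rightarrow> ('a \<Rightarrow> ereal) \<Rightarrow> bool" where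
  "satisfies_LDP M V J \<longleftrightarrow>
     (\<forall>n\<ge>1. V n \<in> borel_measurable M) \<and>
     (\<forall>x. 0 \<le> J x) \<and> lower_semicontinuous J \<and>
     (\<forall>F. closed F \<longrightarrow>
        limsup (\<lambda>n. ereal (1 / real n) * log_prob (measure M {\<omega> \<in> space M. V n \<omega> \<in> F}))
          \<le> - (INF x\<in>F. J x)) \<and>
     (\<forall>G. open G \<longrightarrow>
        - (INF x\<in>G. J x)
          \<le> liminf (\<lambda>n. ereal (1 / real n) * log_prob (measure M {\<omega> \<in> space M. V n \<omega> \<in> G})))"

definition good_rate_function :: "('a::euclidean_space \<Rightarrow> ereal) \<Rightarrow> bool" where
  "good_rate_function J \<longleftrightarrow> (\<forall>b::real. compact (J -` {0..ereal b}))"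

definition J_S :: "real \<Rightarrow> real \<times> real \<Rightarrow> ereal" where
  "J_S \<theta> = (\<lambda>(x, y).
     if y > x\<^sup>2 then
       ereal (1/2 * (y * (1 + \<theta>\<^sup>2) - 2 * x\<^sup>2 * \<theta> - sqrt (1 + 4 * \<theta>\<^sup>2 * (y - x\<^sup>2)\<^sup>2)
         - ln (2 * (y - x\<^sup>2) / (1 + sqrt (1 + 4 * \<theta>\<^sup>2 * (y - x\<^sup>2)\<^sup>2)))))
     else \<infinity>)"

end

theory Submission
  imports Defs
begin

text \<open>
  Tilting the law of the first \<open>n\<close> observations by \<open>exp (\<lambda> \<Sum>X\<^sub>k + \<mu> \<Sum>X\<^sub>k\<^sup>2)\<close> produces, up to a factor that
  depends on the endpoints only, the law of another autoregression. Indeed the Gaussian density of an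
  autoregression with coefficient \<open>\<phi>\<close> and innovation variance \<open>w\<close> contains the products \<open>X\<^sub>k X\<^sub>k\<^sub>+\<^sub>1\<close> with
  coefficient \<open>\<phi> / w\<close>; they cancel against those of the given process exactly if \<open>\<phi> = \<theta> w\<close>. The
  innovation variance \<open>w\<close> and the intercept \<open>c\<close> of the tilted autoregression remain free and
  parametrise the multipliers \<open>\<lambda>\<close>, \<open>\<mu>\<close> and the normalising constant \<open>\<Lambda>\<close> per step
  (\<open>one_step_tilt\<close>, \<open>change_of_measure\<close>). Its stationary law has variance \<open>w / (1 - \<theta>\<^sup>2 w\<^sup>2)\<close>; solving
  this for \<open>w\<close> when the variance is \<open>y - x\<^sup>2\<close> is where the square root in the rate function comes from.

  The rate function is the pointwise supremum of the affine functions \<open>\<lambda>x + \<mu>y - \<Lambda>\<close>; for \<open>y > x\<^sup>2\<close> it is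
  attained by the tilt whose stationary mean and variance are \<open>x\<close> and \<open>y - x\<^sup>2\<close>
  (\<open>tilt_affine_le_J_S\<close>, \<open>J_S_eq_tilt_affine\<close>). Nonnegativity, lower semicontinuity and goodness follow from this
  description.

  For the upper bound, Chebyshev's exponential inequality bounds the probability of a half-plane
  \<open>{\<lambda>x + \<mu>y - \<Lambda> > \<alpha>}\<close> by a constant times \<open>exp (- n \<alpha>)\<close> (\<open>half_space_upper_bound\<close>). The only
  obstacle is the endpoint factor, which may be unbounded; a Lyapunov function of the tilted
  autoregression controls it (\<open>tilted_exp_square_bounded\<close>). Since the empirical moments satisfy
  \<open>x\<^sup>2 \<le> y\<close>, a closed set on which the rate exceeds \<open>\<alpha>\<close> is, as far as it matters, covered by finitely
  many such half-planes (\<open>closed_superlevel_cover\<close>).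

  For the lower bound at a point, the measure is changed to the tilted autoregression centred there;
  under it the empirical moments obey a weak law of large numbers, proved by the second moments of two
  martingales (\<open>tilted_moments\<close>, \<open>tilted_concentration\<close>), and the density is explicit
  (\<open>open_set_lower_bound\<close>).

  The process enters only through the law of the triple consisting of the last observation, the sum
  and the sum of squares, which is a Markov chain (\<open>distr_sums\<close>).
\<close>

section \<open>Two elementary estimates\<close>

text \<open>Both the exponential and the second moment of the tilted autoregression satisfy a drift condition of
  this form, which bounds them uniformly in time.\<close>

lemma affine_recursion_bounded:
  fixes I :: "nat \<Rightarrow> ennreal"
  assumes "0 \<le> \<rho>" "\<rho> < 1" "0 \<le> K" and I0: "I 0 < \<infinity>"
    and step: "\<And>n. I (Suc n) \<le> ennreal \<rho> * I n + ennreal K"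
  obtains B where "0 \<le> B" "\<And>n. I n \<le> ennreal B"
proof -
  obtain i where i: "I 0 = ennreal i" "0 \<le> i"
    using I0 by (metis less_irrefl ennreal_cases infinity_ennreal_def)
  define B where "B = i + K / (1 - \<rho>)"
  have B0: "0 \<le> B"
    using assms i by (simp add: B_def)
  have B: "\<rho> * B + K \<le> B"
  proof -
    have "(1 - \<rho>) * B = (1 - \<rho>) * i + K"
      using assms by (simp add: B_def distrib_left)
    moreover have "0 \<le> (1 - \<rho>) * i"
      using assms i by simp
    ultimately show ?thesis
      by (simp add: algebra_simps)
  qed
  have "I n \<le> ennreal B" for n
  proof (induction n)
    case 0
    then show ?case
      using assms by (simp add: i B_def)
  next
    case (Suc n)
    have "I (Suc n) \<le> ennreal \<rho> * ennreal B + ennreal K"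
      by (intro order_trans[OF step] add_right_mono mult_left_mono Suc) simp
    also have "\<dots> = ennreal (\<rho> * B + K)"
      using assms B0 by (simp add: ennreal_mult)
    also have "\<dots> \<le> ennreal B"
      using B by (rule ennreal_leI)
    finally show ?case .
  qed
  with B0 show ?thesis
    by (rule that)
qed

lemma exp_quadratic_le:
  fixes a b p q \<delta> :: real
  assumes "a < b" "\<delta> > 0"
  obtains K where "0 \<le> K" "\<And>x. exp (a * x\<^sup>2 + p * x + q) \<le> \<delta> * exp (b * x\<^sup>2) + K"
proof -
  define d where "d = b - a"
  have d: "d > 0" using assms by (simp add: d_def)
  \<comment> \<open>Beyond \<open>x\<^sup>2 = R\<close> the difference of the two quadratics exceeds its linear and constant terms
    and \<open>- ln \<delta>\<close>.\<close>
  define R where "R = max (q - ln \<delta> + p\<^sup>2 / (2 * d)) 0 * 2 / d"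
  define K where "K = exp (\<bar>a\<bar> * R + \<bar>p\<bar> * (R + 1) + q)"
  have "exp (a * x\<^sup>2 + p * x + q) \<le> \<delta> * exp (b * x\<^sup>2) + K" for x
  proof (cases "x\<^sup>2 \<le> R")
    case True
    have "\<bar>x\<bar> \<le> R + 1"
    proof -
      have "0 \<le> (\<bar>x\<bar> - 1 / 2)\<^sup>2"
        by simp
      then have "\<bar>x\<bar> \<le> x\<^sup>2 + 1 / 4"
        by (simp add: power2_diff power_divide)
      with True show ?thesis
        by linarith
    qed
    then have "\<bar>p\<bar> * \<bar>x\<bar> \<le> \<bar>p\<bar> * (R + 1)"
      by (intro mult_left_mono) auto
    then have "p * x \<le> \<bar>p\<bar> * (R + 1)"
      using abs_ge_self[of "p * x"] by (simp add: abs_mult)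
    moreover have "a * x\<^sup>2 \<le> \<bar>a\<bar> * R"
      using True by (intro mult_mono) auto
    ultimately have "exp (a * x\<^sup>2 + p * x + q) \<le> K"
      by (simp add: K_def)
    moreover have "0 \<le> \<delta> * exp (b * x\<^sup>2)"
      using assms by simp
    ultimately show ?thesis
      by linarith
  next
    case False
    have "0 \<le> (d * x - p)\<^sup>2 / (2 * d)"
      using d by simp
    also have "\<dots> = d * x\<^sup>2 / 2 - p * x + p\<^sup>2 / (2 * d)"
      using d by (simp add: field_simps power2_eq_square)
    finally have "p * x \<le> d * x\<^sup>2 / 2 + p\<^sup>2 / (2 * d)" by simp
    moreover have "d * x\<^sup>2 / 2 \<ge> q - ln \<delta> + p\<^sup>2 / (2 * d)"
    proof -
      have "d * R / 2 \<le> d * x\<^sup>2 / 2" using False d by simp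
      moreover have "d * R / 2 = max (q - ln \<delta> + p\<^sup>2 / (2 * d)) 0"
        using d by (simp add: R_def)
      ultimately show ?thesis by linarith
    qed
    ultimately have "p * x + q \<le> d * x\<^sup>2 + ln \<delta>" by simp
    then have "a * x\<^sup>2 + p * x + q \<le> ln \<delta> + b * x\<^sup>2"
      by (simp add: d_def algebra_simps)
    then have "exp (a * x\<^sup>2 + p * x + q) \<le> \<delta> * exp (b * x\<^sup>2)"
      using assms exp_le_cancel_iff[of "a * x\<^sup>2 + p * x + q" "ln \<delta> + b * x\<^sup>2"]
      by (simp add: exp_add[of "ln \<delta>"])
    then show ?thesis by (simp add: K_def add_increasing2)
  qed
  then show ?thesis
    using that[of K] by (simp add: K_def)
qed

section \<open>Gaussian integrals\<close>

text \<open>Completing the square; \<open>D / \<sigma>\<^sup>2\<close> is the precision after tilting, so \<open>D > 0\<close> is needed for the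
  result to be a Gaussian density again.\<close>

lemma normal_density_tilt:
  fixes A B m \<sigma> :: real
  assumes "\<sigma> > 0" and "2 * A * \<sigma>\<^sup>2 < 1"
  defines "D \<equiv> 1 - 2 * A * \<sigma>\<^sup>2"
  shows "exp (A * y\<^sup>2 + B * y) * normal_density m \<sigma> y =
    exp ((A * m\<^sup>2 + B * m + B\<^sup>2 * \<sigma>\<^sup>2 / 2) / D) / sqrt D *
      normal_density ((m + B * \<sigma>\<^sup>2) / D) (\<sigma> / sqrt D) y"
proof -
  have D: "D > 0"
    using assms by simp
  have A: "A = (1 - D) / (2 * \<sigma>\<^sup>2)"
    using assms by (simp add: field_simps)
  have "A * y\<^sup>2 + B * y - (y - m)\<^sup>2 / (2 * \<sigma>\<^sup>2) =
     (A * m\<^sup>2 + B * m + B\<^sup>2 * \<sigma>\<^sup>2 / 2) / D - (y - (m + B * \<sigma>\<^sup>2) / D)\<^sup>2 / (2 * (\<sigma> / sqrt D)\<^sup>2)"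
    unfolding A using D \<open>\<sigma> > 0\<close>
    by (simp add: power_divide field_simps power2_eq_square)
  then have "exp (A * y\<^sup>2 + B * y) * exp (- (y - m)\<^sup>2 / (2 * \<sigma>\<^sup>2)) =
     exp ((A * m\<^sup>2 + B * m + B\<^sup>2 * \<sigma>\<^sup>2 / 2) / D) * exp (- (y - (m + B * \<sigma>\<^sup>2) / D)\<^sup>2 / (2 * (\<sigma> / sqrt D)\<^sup>2))"
    unfolding exp_add[symmetric] by simp
  moreover have "sqrt (2 * pi * (\<sigma> / sqrt D)\<^sup>2) = sqrt (2 * pi * \<sigma>\<^sup>2) / sqrt D"
    using D by (simp add: power_divide real_sqrt_divide)
  ultimately show ?thesis
    using D \<open>\<sigma> > 0\<close> unfolding normal_density_def by (simp add: field_simps)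
qed

lemma nn_integral_exp_quadratic_normal:
  fixes A B m \<sigma> :: real
  assumes "\<sigma> > 0" and "2 * A * \<sigma>\<^sup>2 < 1"
  defines "D \<equiv> 1 - 2 * A * \<sigma>\<^sup>2"
  shows "(\<integral>\<^sup>+y. ennreal (normal_density m \<sigma> y) * ennreal (exp (A * y\<^sup>2 + B * y)) \<partial>lborel) =
    ennreal (exp ((A * m\<^sup>2 + B * m + B\<^sup>2 * \<sigma>\<^sup>2 / 2) / D) / sqrt D)"
proof -
  have D: "D > 0"
    using assms by simp
  interpret N: prob_space "density lborel (normal_density ((m + B * \<sigma>\<^sup>2) / D) (\<sigma> / sqrt D))"
    using D assms by (intro prob_space_normal_density) simp
  have 1: "(\<integral>\<^sup>+y. ennreal (normal_density ((m + B * \<sigma>\<^sup>2) / D) (\<sigma> / sqrt D) y) \<partial>lborel) = 1"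
    using N.emeasure_space_1 by (simp add: emeasure_density)
  have "(\<integral>\<^sup>+y. ennreal (normal_density m \<sigma> y) * ennreal (exp (A * y\<^sup>2 + B * y)) \<partial>lborel) =
    (\<integral>\<^sup>+y. ennreal (exp ((A * m\<^sup>2 + B * m + B\<^sup>2 * \<sigma>\<^sup>2 / 2) / D) / sqrt D) *
       ennreal (normal_density ((m + B * \<sigma>\<^sup>2) / D) (\<sigma> / sqrt D) y) \<partial>lborel)"
    using normal_density_tilt[OF assms(1,2), folded D_def, of _ B m] D
    by (intro nn_integral_cong) (simp add: ennreal_mult[symmetric] mult.commute)
  then show ?thesis
    by (simp add: nn_integral_cmult 1)
qed

lemma nn_integral_affine_std_normal:
  assumes [measurable]: "f \<in> borel_measurable borel" and "\<sigma> > 0"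
  shows "(\<integral>\<^sup>+e. f (m + \<sigma> * e) \<partial>density lborel std_normal_density) =
    (\<integral>\<^sup>+y. ennreal (normal_density m \<sigma> y) * f y \<partial>lborel)"
proof -
  have d: "std_normal_density e = \<sigma> * normal_density m \<sigma> (m + \<sigma> * e)" for e
    using \<open>\<sigma> > 0\<close> by (simp add: normal_density_def real_sqrt_mult power_mult_distrib)
  have "(\<integral>\<^sup>+y. ennreal (normal_density m \<sigma> y) * f y \<partial>lborel) =
     ennreal \<sigma> * (\<integral>\<^sup>+e. ennreal (normal_density m \<sigma> (m + \<sigma> * e)) * f (m + \<sigma> * e) \<partial>lborel)"
    using \<open>\<sigma> > 0\<close> by (subst nn_integral_real_affine[where c = \<sigma> and t = m]) auto
  also have "\<dots> = (\<integral>\<^sup>+e. ennreal (std_normal_density e) * f (m + \<sigma> * e) \<partial>lborel)"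
    using \<open>\<sigma> > 0\<close>
    by (subst nn_integral_cmult[symmetric]) (auto simp: d ennreal_mult' mult.assoc intro!: nn_integral_cong)
  also have "\<dots> = (\<integral>\<^sup>+e. f (m + \<sigma> * e) \<partial>density lborel std_normal_density)"
    by (subst nn_integral_density) auto
  finally show ?thesis ..
qed

text \<open>The polynomials \<open>1\<close>, \<open>e\<close>, \<open>e\<^sup>2 - 1\<close> are orthogonal with squared norms \<open>1\<close>, \<open>1\<close>, \<open>2\<close>. All increments
  whose second moments are computed below are combinations of them.\<close>

lemma std_normal_second_moment:
  fixes a b d :: real
  shows "(\<integral>\<^sup>+e. ennreal ((a + b * e + d * (e\<^sup>2 - 1))\<^sup>2) \<partial>density lborel std_normal_density) =
    ennreal (a\<^sup>2 + b\<^sup>2 + 2 * d\<^sup>2)"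
proof -
  let ?g = std_normal_density
  have m0: "has_bochner_integral lborel (\<lambda>e. ?g e) 1"
    using std_normal_moment_even[of 0] by simp
  have m1: "has_bochner_integral lborel (\<lambda>e. ?g e * e) 0"
    using std_normal_moment_odd[of 0] by simp
  have m2: "has_bochner_integral lborel (\<lambda>e. ?g e * e ^ 2) 1"
    using std_normal_moment_even[of 1] by (simp add: fact_numeral)
  have m3: "has_bochner_integral lborel (\<lambda>e. ?g e * e ^ 3) 0"
    using std_normal_moment_odd[of 1] by (simp add: numeral_3_eq_3)
  have m4: "has_bochner_integral lborel (\<lambda>e. ?g e * e ^ 4) 3"
    using std_normal_moment_even[of 2] by (simp add: fact_numeral)
  have "has_bochner_integral lborel
     (\<lambda>e. (a - d)\<^sup>2 * ?g e + (2 * (a - d) * b * (?g e * e) + ((b\<^sup>2 + 2 * (a - d) * d) * (?g e * e ^ 2) +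
        (2 * b * d * (?g e * e ^ 3) + d\<^sup>2 * (?g e * e ^ 4)))))
     ((a - d)\<^sup>2 * 1 + (2 * (a - d) * b * 0 + ((b\<^sup>2 + 2 * (a - d) * d) * 1 + (2 * b * d * 0 + d\<^sup>2 * 3))))"
    by (intro has_bochner_integral_add has_bochner_integral_mult_right m0 m1 m2 m3 m4)
  moreover have "(\<lambda>e. (a - d)\<^sup>2 * ?g e + (2 * (a - d) * b * (?g e * e) + ((b\<^sup>2 + 2 * (a - d) * d) * (?g e * e ^ 2) +
        (2 * b * d * (?g e * e ^ 3) + d\<^sup>2 * (?g e * e ^ 4))))) = (\<lambda>e. ?g e * (a + b * e + d * (e\<^sup>2 - 1))\<^sup>2)"
    by (rule ext) (simp add: power2_eq_square power3_eq_cube power4_eq_xxxx algebra_simps)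
  moreover have "(a - d)\<^sup>2 * 1 + (2 * (a - d) * b * 0 + ((b\<^sup>2 + 2 * (a - d) * d) * 1 + (2 * b * d * 0 + d\<^sup>2 * 3))) =
      a\<^sup>2 + b\<^sup>2 + 2 * d\<^sup>2"
    by (simp add: power2_eq_square algebra_simps)
  ultimately have h: "has_bochner_integral lborel (\<lambda>e. ?g e * (a + b * e + d * (e\<^sup>2 - 1))\<^sup>2) (a\<^sup>2 + b\<^sup>2 + 2 * d\<^sup>2)"
    by (simp only:)
  have "(\<integral>\<^sup>+e. ennreal ((a + b * e + d * (e\<^sup>2 - 1))\<^sup>2) \<partial>density lborel ?g) =
     (\<integral>\<^sup>+e. ennreal (?g e * (a + b * e + d * (e\<^sup>2 - 1))\<^sup>2) \<partial>lborel)"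
    by (subst nn_integral_density) (auto simp: ennreal_mult)
  also have "\<dots> = ennreal (a\<^sup>2 + b\<^sup>2 + 2 * d\<^sup>2)"
    using h by (subst nn_integral_eq_integral)
      (auto simp: has_bochner_integral_iff)
  finally show ?thesis .
qed

lemma chebyshev_nn_integral:
  fixes f :: "'a \<Rightarrow> real"
  assumes [measurable]: "f \<in> borel_measurable N" and "(\<integral>\<^sup>+x. ennreal ((f x)\<^sup>2) \<partial>N) \<le> ennreal K"
    and "r > 0"
  shows "emeasure N {x \<in> space N. r < \<bar>f x\<bar>} \<le> ennreal (K / r\<^sup>2)"
proof -
  have "1 \<le> 1 / r\<^sup>2 * (f x)\<^sup>2" if "r < \<bar>f x\<bar>" for x
    using that \<open>r > 0\<close> abs_le_square_iff[of r "f x"] by simp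
  then have "emeasure N {x \<in> space N. r < \<bar>f x\<bar>} \<le> emeasure N {x \<in> space N. 1 \<le> ennreal (1 / r\<^sup>2) * ennreal ((f x)\<^sup>2)}"
    using \<open>r > 0\<close> by (intro emeasure_mono) (auto simp: ennreal_mult[symmetric] simp del: ennreal_1 simp flip: ennreal_1)
  also have "\<dots> \<le> ennreal (1 / r\<^sup>2) * (\<integral>\<^sup>+x. ennreal ((f x)\<^sup>2) \<partial>N)"
  proof -
    have "(\<integral>\<^sup>+x. ennreal ((f x)\<^sup>2) * indicator (space N) x \<partial>N) = (\<integral>\<^sup>+x. ennreal ((f x)\<^sup>2) \<partial>N)"
      by (intro nn_integral_cong) simp
    moreover have "{x \<in> space N. 1 \<le> ennreal (1 / r\<^sup>2) * ennreal ((f x)\<^sup>2)} \<inter> space N =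
       {x \<in> space N. 1 \<le> ennreal (1 / r\<^sup>2) * ennreal ((f x)\<^sup>2)}"
      by auto
    ultimately show ?thesis
      using nn_integral_Markov_inequality[of "\<lambda>x. ennreal ((f x)\<^sup>2)" "space N" N "ennreal (1 / r\<^sup>2)"]
      by simp
  qed
  also have "\<dots> \<le> ennreal (1 / r\<^sup>2) * ennreal K"
    by (intro mult_left_mono assms) simp
  also have "\<dots> = ennreal (K / r\<^sup>2)"
    using \<open>r > 0\<close> by (simp add: ennreal_mult'[symmetric])
  finally show ?thesis .
qed

section \<open>The Markov chain of partial sums\<close>

lemma borel_measurable_fst_borel [measurable (raw)]:
  fixes g :: "'a \<Rightarrow> 'b::second_countable_topology \<times> 'c::second_countable_topology"
  assumes "g \<in> borel_measurable N"
  shows "(\<lambda>u. fst (g u)) \<in> borel_measurable N"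
  using assms by (simp add: borel_prod[symmetric])

lemma borel_measurable_snd_borel [measurable (raw)]:
  fixes g :: "'a \<Rightarrow> 'b::second_countable_topology \<times> 'c::second_countable_topology"
  assumes "g \<in> borel_measurable N"
  shows "(\<lambda>u. snd (g u)) \<in> borel_measurable N"
  using assms by (simp add: borel_prod[symmetric])

definition chain_step :: "real \<Rightarrow> real \<times> real \<times> real \<Rightarrow> real \<times> real \<times> real" where
  "chain_step y = (\<lambda>(x, s, t). (y, s + y, t + y\<^sup>2))"

text \<open>The law of \<open>(X\<^sub>n\<^sub>+\<^sub>1, \<Sum>X\<^sub>k, \<Sum>X\<^sub>k\<^sup>2)\<close> with sums over \<open>k = 1, \<dots>, n + 1\<close>: the index counts transitions, so the
  number of observations is \<open>n + 1\<close>. The initial law \<open>\<nu>\<close> may be any measure, because the tilted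
  chain starts from an unnormalised one.\<close>

primrec ar_chain :: "real \<Rightarrow> real \<Rightarrow> real \<Rightarrow> real measure \<Rightarrow> nat \<Rightarrow> (real \<times> real \<times> real) measure" where
  "ar_chain \<phi> c \<sigma> \<nu> 0 = distr \<nu> borel (\<lambda>x. (x, x, x\<^sup>2))"
| "ar_chain \<phi> c \<sigma> \<nu> (Suc n) =
     distr (ar_chain \<phi> c \<sigma> \<nu> n \<Otimes>\<^sub>M density lborel std_normal_density) borel
       (\<lambda>(z, e). chain_step (\<phi> * fst z + c + \<sigma> * e) z)"

lemma sets_chain [simp, measurable_cong]: "sets (ar_chain \<phi> c \<sigma> \<nu> n) = sets borel"
  by (cases n) auto

lemma space_chain [simp]: "space (ar_chain \<phi> c \<sigma> \<nu> n) = UNIV"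
  by (cases n) auto

lemma chain_step_measurable [measurable]:
  assumes [measurable]: "f \<in> borel_measurable N" "g \<in> borel_measurable N"
  shows "(\<lambda>u. chain_step (f u) (g u)) \<in> borel_measurable N"
proof -
  have "(\<lambda>u. (f u, fst (snd (g u)) + f u, snd (snd (g u)) + (f u)\<^sup>2)) \<in> borel_measurable N"
    by measurable
  then show ?thesis
    by (simp add: chain_step_def case_prod_beta)
qed

lemma nn_integral_chain_0:
  assumes [measurable_cong]: "sets \<nu> = sets borel" and [measurable]: "f \<in> borel_measurable borel"
  shows "(\<integral>\<^sup>+z. f z \<partial>ar_chain \<phi> c \<sigma> \<nu> 0) = (\<integral>\<^sup>+x. f (x, x, x\<^sup>2) \<partial>\<nu>)"
  unfolding ar_chain.simps by (subst nn_integral_distr) auto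

lemma nn_integral_chain_Suc:
  assumes [measurable]: "f \<in> borel_measurable borel"
  shows "(\<integral>\<^sup>+z. f z \<partial>ar_chain \<phi> c \<sigma> \<nu> (Suc n)) =
    (\<integral>\<^sup>+z. (\<integral>\<^sup>+e. f (chain_step (\<phi> * fst z + c + \<sigma> * e) z) \<partial>density lborel std_normal_density)
       \<partial>ar_chain \<phi> c \<sigma> \<nu> n)"
proof -
  interpret N: prob_space "density lborel std_normal_density"
    by (rule prob_space_normal_density) simp
  have "(\<integral>\<^sup>+z. f z \<partial>ar_chain \<phi> c \<sigma> \<nu> (Suc n)) =
     (\<integral>\<^sup>+p. f (chain_step (\<phi> * fst (fst p) + c + \<sigma> * snd p) (fst p))
        \<partial>(ar_chain \<phi> c \<sigma> \<nu> n \<Otimes>\<^sub>M density lborel std_normal_density))"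
    unfolding ar_chain.simps by (subst nn_integral_distr) (auto simp: case_prod_beta)
  also have "\<dots> = (\<integral>\<^sup>+z. (\<integral>\<^sup>+e. f (chain_step (\<phi> * fst z + c + \<sigma> * e) z)
       \<partial>density lborel std_normal_density) \<partial>ar_chain \<phi> c \<sigma> \<nu> n)"
    by (subst N.nn_integral_fst[symmetric]) auto
  finally show ?thesis .
qed

lemma emeasure_chain:
  assumes [measurable_cong]: "sets \<nu> = sets borel"
  shows "emeasure (ar_chain \<phi> c \<sigma> \<nu> n) UNIV = emeasure \<nu> UNIV"
proof (induction n)
  case 0
  have "space \<nu> = UNIV"
    using sets_eq_imp_space_eq[OF assms] by simp
  then show ?case
    using nn_integral_chain_0[OF assms, of "\<lambda>_. 1" \<phi> c \<sigma>] by simp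
next
  case (Suc n)
  interpret N: prob_space "density lborel std_normal_density"
    by (rule prob_space_normal_density) simp
  have "(\<integral>\<^sup>+z. 1 \<partial>ar_chain \<phi> c \<sigma> \<nu> (Suc n)) = (\<integral>\<^sup>+z. 1 \<partial>ar_chain \<phi> c \<sigma> \<nu> n)"
    using N.emeasure_space_1 by (subst nn_integral_chain_Suc) auto
  then show ?case
    using Suc by simp
qed

section \<open>Exponential tilting\<close>

text \<open>The tilted autoregression is \<open>x \<mapsto> \<theta> w x + c + sqrt w \<cdot> e\<close> with standard normal \<open>e\<close>. The next three
  functions are the multiplier of the sum, the multiplier of the sum of squares and the logarithm of
  the normalising constant per step.\<close>

definition tilt_lam :: "real \<Rightarrow> real \<Rightarrow> real \<Rightarrow> real" where
  "tilt_lam \<theta> w c = c * (1 - \<theta> * w) / w"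

definition tilt_mu :: "real \<Rightarrow> real \<Rightarrow> real" where
  "tilt_mu \<theta> w = (1 + \<theta>\<^sup>2 - \<theta>\<^sup>2 * w - 1 / w) / 2"

definition tilt_Lam :: "real \<Rightarrow> real \<Rightarrow> real" where
  "tilt_Lam w c = ln w / 2 + c\<^sup>2 / (2 * w)"

text \<open>The endpoint factor: the eigenfunction, with eigenvalue \<open>exp \<Lambda>\<close>, of the transition kernel weighted
  by \<open>exp (\<lambda>y + \<mu>y\<^sup>2)\<close>.\<close>

definition tilt_h :: "real \<Rightarrow> real \<Rightarrow> real \<Rightarrow> real \<Rightarrow> real" where
  "tilt_h \<theta> w c x = exp (\<theta>\<^sup>2 * (w - 1) / 2 * x\<^sup>2 + \<theta> * c * x)"

definition tilt_weight :: "real \<Rightarrow> real \<Rightarrow> real \<Rightarrow> real \<times> real \<times> real \<Rightarrow> real" where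
  "tilt_weight \<theta> w c = (\<lambda>(x, s, t). exp (tilt_lam \<theta> w c * s + tilt_mu \<theta> w * t) * tilt_h \<theta> w c x)"

definition ar_stationary :: "real \<Rightarrow> real measure" where
  "ar_stationary \<theta> = density lborel (normal_density 0 (sqrt (1 / (1 - \<theta>\<^sup>2))))"

definition tilt_initial :: "real \<Rightarrow> real \<Rightarrow> real \<Rightarrow> real measure" where
  "tilt_initial \<theta> w c = density (ar_stationary \<theta>) (\<lambda>x. ennreal (tilt_weight \<theta> w c (x, x, x\<^sup>2)))"

lemma sets_ar_stationary [simp, measurable_cong]: "sets (ar_stationary \<theta>) = sets borel"
  by (simp add: ar_stationary_def)

lemma sets_tilt_initial [simp, measurable_cong]: "sets (tilt_initial \<theta> w c) = sets borel"
  by (simp add: tilt_initial_def)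

lemma space_tilt_initial [simp]: "space (tilt_initial \<theta> w c) = UNIV"
  by (simp add: tilt_initial_def ar_stationary_def)

lemma tilt_h_pos [simp]: "0 < tilt_h \<theta> w c x"
  by (simp add: tilt_h_def)

lemma tilt_h_nonzero [simp]: "tilt_h \<theta> w c x \<noteq> 0"
  by (simp add: tilt_h_def)

lemma tilt_weight_pos [simp]: "0 < tilt_weight \<theta> w c z"
  by (simp add: tilt_weight_def case_prod_beta)

lemma tilt_h_measurable [measurable (raw)]:
  fixes f :: "'a \<Rightarrow> real"
  assumes [measurable]: "f \<in> borel_measurable N"
  shows "(\<lambda>u. tilt_h \<theta> w c (f u)) \<in> borel_measurable N"
  by (simp add: tilt_h_def)

lemma tilt_weight_measurable [measurable (raw)]:
  fixes f :: "'a \<Rightarrow> real \<times> real \<times> real"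
  assumes [measurable]: "f \<in> borel_measurable N"
  shows "(\<lambda>u. tilt_weight \<theta> w c (f u)) \<in> borel_measurable N"
  unfolding tilt_weight_def case_prod_beta by measurable

text \<open>For \<open>\<theta> \<noteq> 0\<close> the multiplier of the sum of squares takes the same value at \<open>w\<close> and at
  \<open>1 / (\<theta>\<^sup>2 w)\<close>; the condition \<open>\<bar>\<theta>\<bar> w < 1\<close> selects the one of the two for which the tilted
  autoregression is stable.\<close>

locale tilt =
  fixes \<theta> w c :: real
  assumes abs_theta: "\<bar>\<theta>\<bar> < 1" and w_pos: "0 < w" and abs_theta_w: "\<bar>\<theta>\<bar> * w < 1"
begin

abbreviation "lam \<equiv> tilt_lam \<theta> w c"
abbreviation "mu \<equiv> tilt_mu \<theta> w"
abbreviation "Lam \<equiv> tilt_Lam w c"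
abbreviation "h \<equiv> tilt_h \<theta> w c"
abbreviation "W \<equiv> tilt_weight \<theta> w c"
abbreviation "\<nu> \<equiv> tilt_initial \<theta> w c"
abbreviation "P \<equiv> ar_chain \<theta> 0 1 (ar_stationary \<theta>)"
abbreviation "Q \<equiv> ar_chain (\<theta> * w) c (sqrt w) \<nu>"

lemma abs_phi_less_1: "\<bar>\<theta> * w\<bar> < 1"
  using abs_theta_w w_pos by (simp add: abs_mult)

lemma phi_square_less_1: "\<theta>\<^sup>2 * w\<^sup>2 < 1"
  using abs_phi_less_1 by (simp add: abs_square_less_1 power_mult_distrib[symmetric])

lemma theta_square_less_1: "\<theta>\<^sup>2 < 1"
  using abs_theta by (simp add: abs_square_less_1)

lemma theta_square_w_less_1: "\<theta>\<^sup>2 * w < 1"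
proof -
  have "\<theta>\<^sup>2 * w = \<bar>\<theta>\<bar> * (\<bar>\<theta>\<bar> * w)"
    by (simp add: power2_eq_square)
  also have "\<dots> \<le> 1 * (\<bar>\<theta>\<bar> * w)"
    using abs_theta w_pos by (intro mult_right_mono) auto
  finally show ?thesis
    using abs_theta_w by simp
qed

text \<open>In the exponential factor \<open>y\<^sup>2\<close> has total coefficient \<open>(1 - 1 / w) / 2\<close> and \<open>y\<close> has \<open>c / w\<close>; completing
  the square turns variance \<open>1\<close> into \<open>w\<close> and mean \<open>\<theta> x\<close> into \<open>w (\<theta> x + c / w)\<close>.\<close>

lemma one_step_tilt:
  "normal_density (\<theta> * x) 1 y * (exp (lam * y + mu * y\<^sup>2) * h y) =
     exp Lam * h x * normal_density (\<theta> * w * x + c) (sqrt w) y"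
proof -
  have e1: "lam * y + mu * y\<^sup>2 + (\<theta>\<^sup>2 * (w - 1) / 2 * y\<^sup>2 + \<theta> * c * y) =
      (1 - 1 / w) / 2 * y\<^sup>2 + c / w * y"
    using w_pos by (simp add: tilt_lam_def tilt_mu_def field_simps)
  have D: "1 - 2 * ((1 - 1 / w) / 2) * 1\<^sup>2 = 1 / w"
    using w_pos by (simp add: field_simps)
  have e2: "((1 - 1 / w) / 2 * (\<theta> * x)\<^sup>2 + c / w * (\<theta> * x) + (c / w)\<^sup>2 * 1\<^sup>2 / 2) / (1 / w) =
     c\<^sup>2 / (2 * w) + (\<theta>\<^sup>2 * (w - 1) / 2 * x\<^sup>2 + \<theta> * c * x)"
    using w_pos by (simp add: field_simps power2_eq_square)
  have e3: "(\<theta> * x + c / w * 1\<^sup>2) / (1 / w) = \<theta> * w * x + c" "1 / sqrt (1 / w) = sqrt w"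
    using w_pos by (simp_all add: field_simps real_sqrt_divide)
  have e4: "exp (ln w / 2) = sqrt w"
    using w_pos by (simp add: ln_sqrt[symmetric])
  have "exp (lam * y + mu * y\<^sup>2) * h y = exp ((1 - 1 / w) / 2 * y\<^sup>2 + c / w * y)"
    unfolding tilt_h_def exp_add[symmetric] e1 ..
  moreover have "exp ((1 - 1 / w) / 2 * y\<^sup>2 + c / w * y) * normal_density (\<theta> * x) 1 y =
     exp (c\<^sup>2 / (2 * w) + (\<theta>\<^sup>2 * (w - 1) / 2 * x\<^sup>2 + \<theta> * c * x)) / sqrt (1 / w) *
       normal_density (\<theta> * w * x + c) (sqrt w) y"
    using normal_density_tilt[of 1 "(1 - 1 / w) / 2" y "c / w" "\<theta> * x"] w_pos
    unfolding D e2 e3 by simp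
  ultimately have "normal_density (\<theta> * x) 1 y * (exp (lam * y + mu * y\<^sup>2) * h y) =
     exp (c\<^sup>2 / (2 * w) + (\<theta>\<^sup>2 * (w - 1) / 2 * x\<^sup>2 + \<theta> * c * x)) * sqrt w *
       normal_density (\<theta> * w * x + c) (sqrt w) y"
    by (simp add: real_sqrt_divide mult.commute)
  then show ?thesis
    by (simp add: tilt_h_def tilt_Lam_def exp_add e4 mult_ac)
qed

lemma weight_chain_step:
  "W (chain_step y z) = exp (lam * fst (snd z) + mu * snd (snd z)) * (exp (lam * y + mu * y\<^sup>2) * h y)"
  by (simp add: tilt_weight_def chain_step_def case_prod_beta exp_add[symmetric] algebra_simps)

lemma weight_eq: "W z = exp (lam * fst (snd z) + mu * snd (snd z)) * h (fst z)"
  by (simp add: tilt_weight_def case_prod_beta)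

text \<open>The iteration of \<open>one_step_tilt\<close>. The function \<open>f\<close> is generalised in the induction, because
  integrating out the last innovation replaces it by its conditional expectation under the tilted chain.\<close>

lemma change_of_measure:
  assumes "f \<in> borel_measurable borel"
  shows "(\<integral>\<^sup>+z. f z * ennreal (W z) \<partial>P n) = ennreal (exp (real n * Lam)) * (\<integral>\<^sup>+z. f z \<partial>Q n)"
  using assms
proof (induction n arbitrary: f)
  case 0
  then have [measurable]: "f \<in> borel_measurable borel" .
  show ?case
    unfolding of_nat_0 mult_zero_left exp_zero ennreal_1 mult_1
    by (subst (1 2) nn_integral_chain_0)
       (auto simp: tilt_initial_def nn_integral_density mult.commute)
next
  case (Suc n)
  note [measurable] = Suc.prems
  interpret N: prob_space "density lborel std_normal_density"
    by (rule prob_space_normal_density) simp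
  define F where "F z = (\<integral>\<^sup>+e. f (chain_step (\<theta> * w * fst z + c + sqrt w * e) z)
      \<partial>density lborel std_normal_density)" for z
  have F [measurable]: "F \<in> borel_measurable borel"
    unfolding F_def by measurable
  have one: "(\<integral>\<^sup>+e. f (chain_step (\<theta> * fst z + 0 + 1 * e) z) *
          ennreal (W (chain_step (\<theta> * fst z + 0 + 1 * e) z)) \<partial>density lborel std_normal_density) =
      ennreal (exp Lam) * (F z * ennreal (W z))" for z
  proof -
    have "(\<integral>\<^sup>+e. f (chain_step (\<theta> * fst z + 0 + 1 * e) z) *
          ennreal (W (chain_step (\<theta> * fst z + 0 + 1 * e) z)) \<partial>density lborel std_normal_density) =
      (\<integral>\<^sup>+y. ennreal (normal_density (\<theta> * fst z + 0) 1 y) *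
         (f (chain_step y z) * ennreal (W (chain_step y z))) \<partial>lborel)"
      by (subst nn_integral_affine_std_normal[where f = "\<lambda>y. f (chain_step y z) * ennreal (W (chain_step y z))"])
         auto
    also have "\<dots> = (\<integral>\<^sup>+y. ennreal (exp Lam * W z) *
        (ennreal (normal_density (\<theta> * w * fst z + c) (sqrt w) y) * f (chain_step y z)) \<partial>lborel)"
    proof (rule nn_integral_cong)
      fix y
      have "normal_density (\<theta> * fst z + 0) 1 y * W (chain_step y z) =
        exp Lam * W z * normal_density (\<theta> * w * fst z + c) (sqrt w) y"
        using one_step_tilt[of "fst z" y]
        by (simp add: weight_chain_step weight_eq[of z] mult.assoc mult.left_commute)
      then have "ennreal (normal_density (\<theta> * fst z + 0) 1 y) * ennreal (W (chain_step y z)) =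
        ennreal (exp Lam * W z) * ennreal (normal_density (\<theta> * w * fst z + c) (sqrt w) y)"
        using w_pos by (simp add: ennreal_mult[symmetric] less_imp_le)
      then show "ennreal (normal_density (\<theta> * fst z + 0) 1 y) *
           (f (chain_step y z) * ennreal (W (chain_step y z))) =
         ennreal (exp Lam * W z) *
        (ennreal (normal_density (\<theta> * w * fst z + c) (sqrt w) y) * f (chain_step y z))"
        by (simp add: mult_ac)
    qed
    also have "\<dots> = ennreal (exp Lam * W z) * F z"
      unfolding F_def using w_pos
      by (subst nn_integral_affine_std_normal) (auto simp: nn_integral_cmult)
    finally show ?thesis
      by (simp add: ennreal_mult less_imp_le mult_ac)
  qed
  have "(\<integral>\<^sup>+z. f z * ennreal (W z) \<partial>P (Suc n)) =
     (\<integral>\<^sup>+z. ennreal (exp Lam) * (F z * ennreal (W z)) \<partial>P n)"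
    by (subst nn_integral_chain_Suc) (simp_all only: one, measurable)
  also have "\<dots> = ennreal (exp Lam) * (ennreal (exp (real n * Lam)) * (\<integral>\<^sup>+z. F z \<partial>Q n))"
    by (subst nn_integral_cmult) (auto simp: Suc.IH[OF F])
  also have "\<dots> = ennreal (exp (real (Suc n) * Lam)) * (\<integral>\<^sup>+z. F z \<partial>Q n)"
    by (simp add: mult.assoc[symmetric] ennreal_mult[symmetric] exp_add[symmetric] algebra_simps)
  also have "(\<integral>\<^sup>+z. F z \<partial>Q n) = (\<integral>\<^sup>+z. f z \<partial>Q (Suc n))"
    unfolding F_def by (subst nn_integral_chain_Suc) auto
  finally show ?case .
qed

text \<open>The lower bounds on \<open>\<kappa>\<close> make \<open>exp (\<kappa> x\<^sup>2 / 2)\<close> unbounded and of faster growth than \<open>1 / h\<close>; the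
  upper bounds make it integrable for the tilted initial law, whose precision is \<open>1 / w - \<theta>\<^sup>2\<close>, and for the
  stationary law of the tilted autoregression, whose precision is \<open>1 / w - \<theta>\<^sup>2 w\<close>. The decisive
  comparison \<open>\<theta>\<^sup>2 (1 - w) < 1 / w - \<theta>\<^sup>2\<close> amounts to \<open>2 \<theta>\<^sup>2 w < 1 + \<theta>\<^sup>2 w\<^sup>2\<close>.\<close>

lemma exists_lyapunov_exponent:
  obtains \<kappa> where "0 < \<kappa>" "\<theta>\<^sup>2 * (1 - w) < \<kappa>" "\<kappa> < 1 / w - \<theta>\<^sup>2" "\<kappa> < 1 / w - \<theta>\<^sup>2 * w"
proof -
  have "0 < 1 / w - \<theta>\<^sup>2"
    using theta_square_w_less_1 w_pos by (simp add: field_simps)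
  moreover have "0 < 1 / w - \<theta>\<^sup>2 * w"
    using phi_square_less_1 w_pos by (simp add: field_simps power2_eq_square)
  moreover have "\<theta>\<^sup>2 * (1 - w) < 1 / w - \<theta>\<^sup>2"
  proof -
    have "2 * \<theta>\<^sup>2 * w < 1 + \<theta>\<^sup>2 * w\<^sup>2"
    proof (cases "\<theta> = 0")
      case False
      have "0 < (1 - \<theta>\<^sup>2)"
        using theta_square_less_1 by simp
      moreover have "0 \<le> \<theta>\<^sup>2 * (w - 1)\<^sup>2"
        by simp
      ultimately show ?thesis
        by (simp add: power2_diff algebra_simps)
    qed simp
    then show ?thesis
      using w_pos by (simp add: field_simps power2_eq_square)
  qed
  moreover have "\<theta>\<^sup>2 * (1 - w) < 1 / w - \<theta>\<^sup>2 * w"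
    using theta_square_w_less_1 w_pos by (simp add: field_simps)
  ultimately have "max 0 (\<theta>\<^sup>2 * (1 - w)) < min (1 / w - \<theta>\<^sup>2) (1 / w - \<theta>\<^sup>2 * w)"
    by simp
  then obtain \<kappa> where "max 0 (\<theta>\<^sup>2 * (1 - w)) < \<kappa>" "\<kappa> < min (1 / w - \<theta>\<^sup>2) (1 / w - \<theta>\<^sup>2 * w)"
    using dense by blast
  then show ?thesis
    by (intro that[of \<kappa>]) auto
qed

lemma nn_integral_exp_square_initial:
  assumes "\<kappa> < 1 / w - \<theta>\<^sup>2"
  shows "(\<integral>\<^sup>+x. ennreal (exp (\<kappa> / 2 * x\<^sup>2)) \<partial>\<nu>) < \<infinity>"
proof -
  let ?s = "sqrt (1 / (1 - \<theta>\<^sup>2))"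
  define A where "A = (1 - 1 / w + \<kappa>) / 2"
  have s: "0 < ?s" "?s\<^sup>2 = 1 / (1 - \<theta>\<^sup>2)"
    using theta_square_less_1 by auto
  have A: "2 * A * ?s\<^sup>2 < 1"
    using assms theta_square_less_1 unfolding s A_def by (simp add: pos_divide_less_eq)
  have W: "W (x, x, x\<^sup>2) * exp (\<kappa> / 2 * x\<^sup>2) = exp (A * x\<^sup>2 + c / w * x)" for x
    using w_pos
    by (simp add: tilt_weight_def tilt_h_def exp_add[symmetric] A_def tilt_lam_def tilt_mu_def field_simps)
  have "(\<integral>\<^sup>+x. ennreal (exp (\<kappa> / 2 * x\<^sup>2)) \<partial>\<nu>) =
     (\<integral>\<^sup>+x. ennreal (normal_density 0 ?s x) * ennreal (exp (A * x\<^sup>2 + c / w * x)) \<partial>lborel)"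
  proof -
    have "ennreal (W (x, x, x\<^sup>2)) * ennreal (exp (\<kappa> / 2 * x\<^sup>2)) = ennreal (exp (A * x\<^sup>2 + c / w * x))" for x
      by (simp only: ennreal_mult[symmetric] W exp_ge_zero less_imp_le tilt_weight_pos)
    then show ?thesis
      unfolding tilt_initial_def ar_stationary_def
      by (subst nn_integral_density, simp, simp)+ simp
  qed
  also have "\<dots> < \<infinity>"
    by (subst nn_integral_exp_quadratic_normal[OF s(1) A]) simp
  finally show ?thesis .
qed

lemma emeasure_initial_finite: "emeasure \<nu> UNIV < \<infinity>"
proof -
  obtain \<kappa> where \<kappa>: "0 < \<kappa>" "\<kappa> < 1 / w - \<theta>\<^sup>2"
    using exists_lyapunov_exponent by blast
  have "emeasure \<nu> UNIV = (\<integral>\<^sup>+x. 1 \<partial>\<nu>)"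
    by simp
  also have "\<dots> \<le> (\<integral>\<^sup>+x. ennreal (exp (\<kappa> / 2 * x\<^sup>2)) \<partial>\<nu>)"
    using \<kappa> by (intro nn_integral_mono) simp
  also have "\<dots> < \<infinity>"
    by (rule nn_integral_exp_square_initial[OF \<kappa>(2)])
  finally show ?thesis .
qed

lemma emeasure_initial_pos: "0 < emeasure \<nu> UNIV"
proof -
  interpret N: prob_space "ar_stationary \<theta>"
    unfolding ar_stationary_def using theta_square_less_1 by (intro prob_space_normal_density) simp
  have "emeasure \<nu> UNIV \<noteq> 0"
  proof
    assume "emeasure \<nu> UNIV = 0"
    then have "(\<integral>\<^sup>+x. ennreal (W (x, x, x\<^sup>2)) \<partial>ar_stationary \<theta>) = 0"
      by (simp add: tilt_initial_def emeasure_density)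
    then have "AE x in ar_stationary \<theta>. ennreal (W (x, x, x\<^sup>2)) = 0"
      by (subst (asm) nn_integral_0_iff_AE) auto
    then have "AE x in ar_stationary \<theta>. False"
      by eventually_elim (metis ennreal_eq_0_iff not_le tilt_weight_pos)
    then show False
      using N.AE_False by simp
  qed
  then show ?thesis
    by (simp add: zero_less_iff_neq_zero)
qed

text \<open>\<open>exp (\<kappa> x\<^sup>2 / 2)\<close> is a Lyapunov function: one tilted step multiplies the leading coefficient
  of its exponent by \<open>\<theta>\<^sup>2 w\<^sup>2 / (1 - \<kappa> w) < 1\<close>, which beats every constant factor for large \<open>x\<close>.\<close>

lemma tilted_exp_square_bounded:
  assumes \<kappa>: "0 < \<kappa>" "\<kappa> < 1 / w - \<theta>\<^sup>2" "\<kappa> < 1 / w - \<theta>\<^sup>2 * w"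
  obtains B where "0 \<le> B" "\<And>n. (\<integral>\<^sup>+z. ennreal (exp (\<kappa> / 2 * (fst z)\<^sup>2)) \<partial>Q n) \<le> ennreal B"
proof -
  interpret N: prob_space "density lborel std_normal_density"
    by (rule prob_space_normal_density) simp
  define D where "D = 1 - \<kappa> * w"
  have \<kappa>w: "\<kappa> * w < 1 - \<theta>\<^sup>2 * w\<^sup>2"
    using \<kappa> w_pos by (simp add: field_simps power2_eq_square)
  have "0 \<le> \<theta>\<^sup>2 * w\<^sup>2" by simp
  then have D: "D > 0" and D': "\<theta>\<^sup>2 * w\<^sup>2 < D"
    using \<kappa>w unfolding D_def by linarith+
  have A: "\<kappa> / 2 * (\<theta>\<^sup>2 * w\<^sup>2) / D < \<kappa> / 2"
    using D D' \<kappa> by (simp add: field_simps)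
  obtain K where K: "0 \<le> K" "\<And>x. exp (\<kappa> / 2 * (\<theta>\<^sup>2 * w\<^sup>2) / D * x\<^sup>2 + \<kappa> * \<theta> * w * c / D * x +
      (\<kappa> / 2 * c\<^sup>2 / D - ln D / 2)) \<le> 1/2 * exp (\<kappa> / 2 * x\<^sup>2) + K"
    using exp_quadratic_le[OF A, of "1/2"] by (metis half_gt_zero zero_less_one)
  have step: "(\<integral>\<^sup>+e. ennreal (exp (\<kappa> / 2 * (\<theta> * w * x + c + sqrt w * e)\<^sup>2)) \<partial>density lborel std_normal_density)
     \<le> ennreal (1/2 * exp (\<kappa> / 2 * x\<^sup>2) + K)" for x
  proof -
    have "(\<integral>\<^sup>+e. ennreal (exp (\<kappa> / 2 * (\<theta> * w * x + c + sqrt w * e)\<^sup>2)) \<partial>density lborel std_normal_density) =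
      (\<integral>\<^sup>+y. ennreal (normal_density (\<theta> * w * x + c) (sqrt w) y) * ennreal (exp (\<kappa> / 2 * y\<^sup>2 + 0 * y)) \<partial>lborel)"
      using w_pos
      by (subst nn_integral_affine_std_normal[where f = "\<lambda>y. ennreal (exp (\<kappa> / 2 * y\<^sup>2))"]) auto
    also have "\<dots> = ennreal (exp (\<kappa> / 2 * (\<theta> * w * x + c)\<^sup>2 / D) / sqrt D)"
      using D w_pos by (subst nn_integral_exp_quadratic_normal) (auto simp: D_def)
    also have "exp (\<kappa> / 2 * (\<theta> * w * x + c)\<^sup>2 / D) / sqrt D = exp (\<kappa> / 2 * (\<theta> * w * x + c)\<^sup>2 / D - ln D / 2)"
      using D by (simp add: exp_diff ln_sqrt[symmetric])
    also have "\<kappa> / 2 * (\<theta> * w * x + c)\<^sup>2 / D - ln D / 2 = \<kappa> / 2 * (\<theta>\<^sup>2 * w\<^sup>2) / D * x\<^sup>2 + \<kappa> * \<theta> * w * c / D * x +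
      (\<kappa> / 2 * c\<^sup>2 / D - ln D / 2)"
      using D by (simp add: field_simps power2_eq_square)
    finally show ?thesis
      using K(2)[of x] by (simp add: ennreal_leI)
  qed
  obtain M where M: "emeasure \<nu> UNIV = ennreal M" "0 \<le> M"
    using emeasure_initial_finite by (metis less_irrefl ennreal_cases infinity_ennreal_def)
  show ?thesis
  proof (rule affine_recursion_bounded[where \<rho> = "1/2" and K = "K * M" and
        I = "\<lambda>n. \<integral>\<^sup>+z. ennreal (exp (\<kappa> / 2 * (fst z)\<^sup>2)) \<partial>Q n"])
    show "(\<integral>\<^sup>+z. ennreal (exp (\<kappa> / 2 * (fst z)\<^sup>2)) \<partial>Q 0) < \<infinity>"
      using nn_integral_exp_square_initial[OF \<kappa>(2)] by (subst nn_integral_chain_0) auto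
    fix n
    have "(\<integral>\<^sup>+z. ennreal (exp (\<kappa> / 2 * (fst z)\<^sup>2)) \<partial>Q (Suc n)) =
      (\<integral>\<^sup>+z. (\<integral>\<^sup>+e. ennreal (exp (\<kappa> / 2 * (\<theta> * w * fst z + c + sqrt w * e)\<^sup>2)) \<partial>density lborel std_normal_density) \<partial>Q n)"
      by (subst nn_integral_chain_Suc) (auto simp: chain_step_def case_prod_beta)
    also have "\<dots> \<le> (\<integral>\<^sup>+z. ennreal (1/2) * ennreal (exp (\<kappa> / 2 * (fst z)\<^sup>2)) + ennreal K \<partial>Q n)"
    proof (rule nn_integral_mono)
      show "(\<integral>\<^sup>+e. ennreal (exp (\<kappa> / 2 * (\<theta> * w * fst z + c + sqrt w * e)\<^sup>2)) \<partial>density lborel std_normal_density)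
         \<le> ennreal (1/2) * ennreal (exp (\<kappa> / 2 * (fst z)\<^sup>2)) + ennreal K" for z :: "real \<times> real \<times> real"
        using step[of "fst z"] K
        by (subst (asm) ennreal_plus) (auto simp only: ennreal_mult exp_ge_zero divide_nonneg_nonneg zero_le_one zero_le_numeral mult_nonneg_nonneg)
    qed
    also have "\<dots> = ennreal (1/2) * (\<integral>\<^sup>+z. ennreal (exp (\<kappa> / 2 * (fst z)\<^sup>2)) \<partial>Q n) + ennreal (K * M)"
      using K M by (subst nn_integral_add) (auto simp: nn_integral_cmult emeasure_chain ennreal_mult)
    finally show "(\<integral>\<^sup>+z. ennreal (exp (\<kappa> / 2 * (fst z)\<^sup>2)) \<partial>Q (Suc n)) \<le> \<dots>" .
  qed (use that K M in auto)
qed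

text \<open>Undoing the weight costs the integral of \<open>1 / h\<close> under the tilted chain. For \<open>w < 1\<close> and \<open>\<theta> \<noteq> 0\<close> the
  function \<open>1 / h\<close> grows like the exponential of a square, but it is still dominated by the Lyapunov
  function.\<close>

lemma exponential_moment_bound:
  obtains C where "0 < C"
    "\<And>n. (\<integral>\<^sup>+z. ennreal (exp (lam * fst (snd z) + mu * snd (snd z))) \<partial>P n) \<le> ennreal (C * exp (real n * Lam))"
proof -
  obtain \<kappa> where \<kappa>: "0 < \<kappa>" "\<theta>\<^sup>2 * (1 - w) < \<kappa>" "\<kappa> < 1 / w - \<theta>\<^sup>2" "\<kappa> < 1 / w - \<theta>\<^sup>2 * w"
    using exists_lyapunov_exponent by blast
  obtain B where B: "0 \<le> B" "\<And>n. (\<integral>\<^sup>+z. ennreal (exp (\<kappa> / 2 * (fst z)\<^sup>2)) \<partial>Q n) \<le> ennreal B"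
    using tilted_exp_square_bounded[OF \<kappa>(1,3,4)] by blast
  have "\<theta>\<^sup>2 * (1 - w) / 2 < \<kappa> / 2"
    using \<kappa> by simp
  from exp_quadratic_le[OF this zero_less_one, of "- \<theta> * c" 0]
  obtain K where K: "0 \<le> K" "\<And>x. exp (\<theta>\<^sup>2 * (1 - w) / 2 * x\<^sup>2 - \<theta> * c * x) \<le> exp (\<kappa> / 2 * x\<^sup>2) + K"
    by auto
  have h: "1 / h x \<le> exp (\<kappa> / 2 * x\<^sup>2) + K" for x
  proof -
    have "1 / h x = exp (- (\<theta>\<^sup>2 * (w - 1) / 2 * x\<^sup>2 + \<theta> * c * x))"
      unfolding tilt_h_def exp_minus by (simp add: inverse_eq_divide)
    also have "- (\<theta>\<^sup>2 * (w - 1) / 2 * x\<^sup>2 + \<theta> * c * x) = \<theta>\<^sup>2 * (1 - w) / 2 * x\<^sup>2 - \<theta> * c * x"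
      by (simp add: field_simps)
    finally show ?thesis
      using K(2) by simp
  qed
  obtain M where M: "emeasure \<nu> UNIV = ennreal M" "0 \<le> M"
    using emeasure_initial_finite by (metis less_irrefl ennreal_cases infinity_ennreal_def)
  have bd: "(\<integral>\<^sup>+z. ennreal (exp (lam * fst (snd z) + mu * snd (snd z))) \<partial>P n)
     \<le> ennreal ((B + K * M + 1) * exp (real n * Lam))" for n
  proof -
    have "(\<integral>\<^sup>+z. ennreal (exp (lam * fst (snd z) + mu * snd (snd z))) \<partial>P n) =
       (\<integral>\<^sup>+z. ennreal (1 / h (fst z)) * ennreal (W z) \<partial>P n)"
      by (intro nn_integral_cong) (simp add: weight_eq ennreal_mult[symmetric] less_imp_le del: ennreal_1)
    also have "\<dots> = ennreal (exp (real n * Lam)) * (\<integral>\<^sup>+z. ennreal (1 / h (fst z)) \<partial>Q n)"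
      by (rule change_of_measure) measurable
    finally have eq: "(\<integral>\<^sup>+z. ennreal (exp (lam * fst (snd z) + mu * snd (snd z))) \<partial>P n) =
      ennreal (exp (real n * Lam)) * (\<integral>\<^sup>+z. ennreal (1 / h (fst z)) \<partial>Q n)" .
    have "(\<integral>\<^sup>+z. ennreal (1 / h (fst z)) \<partial>Q n) \<le> (\<integral>\<^sup>+z. ennreal (exp (\<kappa> / 2 * (fst z)\<^sup>2)) + ennreal K \<partial>Q n)"
      using h K by (intro nn_integral_mono) (simp add: ennreal_plus[symmetric] del: ennreal_plus)
    also have "\<dots> \<le> ennreal B + ennreal K * ennreal M"
      using B(2)[of n] M by (subst nn_integral_add) (auto simp: emeasure_chain intro: add_right_mono)
    also have "\<dots> \<le> ennreal (B + K * M + 1)"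
      using B K M by (simp add: ennreal_plus[symmetric] ennreal_mult[symmetric] del: ennreal_plus)
    finally have "(\<integral>\<^sup>+z. ennreal (1 / h (fst z)) \<partial>Q n) \<le> ennreal (B + K * M + 1)" .
    then have "ennreal (exp (real n * Lam)) * (\<integral>\<^sup>+z. ennreal (1 / h (fst z)) \<partial>Q n)
      \<le> ennreal (exp (real n * Lam)) * ennreal (B + K * M + 1)"
      by (rule mult_left_mono) simp
    also have "\<dots> = ennreal ((B + K * M + 1) * exp (real n * Lam))"
      using B K M by (subst ennreal_mult[symmetric]) (auto simp: mult.commute)
    finally show ?thesis
      unfolding eq .
  qed
  show ?thesis
    by (rule that[OF _ bd]) (use B K M in \<open>simp add: add_nonneg_pos\<close>)
qed

end

section \<open>The rate function as a supremum of affine functions\<close>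

definition tilt_affine :: "real \<Rightarrow> real \<Rightarrow> real \<Rightarrow> real \<times> real \<Rightarrow> real" where
  "tilt_affine \<theta> w c = (\<lambda>(x, y). tilt_lam \<theta> w c * x + tilt_mu \<theta> w * y - tilt_Lam w c)"

lemma continuous_on_tilt_affine [continuous_intros]:
  "continuous_on A (tilt_affine \<theta> w c)"
  unfolding tilt_affine_def case_prod_beta by (intro continuous_intros)

lemma (in tilt) tilt_affine_eq:
  "tilt_affine \<theta> w c (x, y) =
    (x\<^sup>2 * (1 - \<theta>)\<^sup>2 + (y - x\<^sup>2) * (1 + \<theta>\<^sup>2 - \<theta>\<^sup>2 * w - 1 / w) - ((1 - \<theta> * w) * x - c)\<^sup>2 / w - ln w) / 2"
  using w_pos
  by (simp add: tilt_affine_def tilt_lam_def tilt_mu_def tilt_Lam_def field_simps power2_eq_square)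

text \<open>The innovation variance \<open>w\<close> for which the tilted autoregression has stationary variance \<open>v\<close>. It is
  the argument of the logarithm in the rate function, and the square root there is linear in \<open>w\<close>.\<close>

lemma variance_parameter:
  fixes \<theta> v :: real
  assumes "v > 0"
  obtains w where "0 < w" "\<bar>\<theta>\<bar> * w < 1" "w = v * (1 - \<theta>\<^sup>2 * w\<^sup>2)"
    "sqrt (1 + 4 * \<theta>\<^sup>2 * v\<^sup>2) = 1 + 2 * \<theta>\<^sup>2 * w * v"
    "2 * v / (1 + sqrt (1 + 4 * \<theta>\<^sup>2 * v\<^sup>2)) = w"
proof -
  define r where "r = sqrt (1 + 4 * \<theta>\<^sup>2 * v\<^sup>2)"
  define w where "w = 2 * v / (1 + r)"
  have r2: "r\<^sup>2 = 1 + 4 * \<theta>\<^sup>2 * v\<^sup>2"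
    unfolding r_def by (subst real_sqrt_pow2) (auto intro: add_nonneg_nonneg)
  have r1: "r \<ge> 1"
    unfolding r_def by simp
  have w: "0 < w"
    using assms r1 by (simp add: w_def)
  have v: "v = w * (1 + r) / 2"
    using r1 by (simp add: w_def)
  have "(r - 1) * (r + 1) = (\<theta>\<^sup>2 * w * (2 * v)) * (1 + r)"
    using r2 by (simp add: v power2_eq_square algebra_simps)
  then have "(r - 1 - 2 * \<theta>\<^sup>2 * w * v) * (1 + r) = 0"
    by (simp add: algebra_simps)
  then have r: "r = 1 + 2 * \<theta>\<^sup>2 * w * v"
    using r1 by simp
  have "v * (\<theta>\<^sup>2 * w\<^sup>2) = w * (r - 1) / 2"
    by (simp add: r power2_eq_square)
  then have weq: "w = v * (1 - \<theta>\<^sup>2 * w\<^sup>2)"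
    by (simp add: v algebra_simps)
  then have "0 < 1 - \<theta>\<^sup>2 * w\<^sup>2"
    using w assms by (metis zero_less_mult_pos)
  then have "(\<bar>\<theta>\<bar> * w)\<^sup>2 < 1"
    by (simp add: power_mult_distrib)
  then have "\<bar>\<theta>\<bar> * w < 1"
    by (simp add: abs_square_less_1)
  then show ?thesis
    using that[of w] w weq r unfolding r_def w_def by simp
qed

lemma J_S_infinity: "y \<le> x\<^sup>2 \<Longrightarrow> J_S \<theta> (x, y) = \<infinity>"
  by (simp add: J_S_def)

lemma J_S_variance:
  assumes "y > x\<^sup>2" "sqrt (1 + 4 * \<theta>\<^sup>2 * (y - x\<^sup>2)\<^sup>2) = 1 + 2 * \<theta>\<^sup>2 * w * (y - x\<^sup>2)"
    "2 * (y - x\<^sup>2) / (1 + sqrt (1 + 4 * \<theta>\<^sup>2 * (y - x\<^sup>2)\<^sup>2)) = w"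
  shows "J_S \<theta> (x, y) = ereal ((y * (1 + \<theta>\<^sup>2) - 2 * x\<^sup>2 * \<theta> - (1 + 2 * \<theta>\<^sup>2 * w * (y - x\<^sup>2)) - ln w) / 2)"
  using assms(1) unfolding J_S_def prod.case assms(3) unfolding assms(2) by simp

text \<open>With \<open>u\<close> the innovation variance belonging to \<open>v = y - x\<^sup>2\<close> and \<open>r = u / w\<close>, twice the difference of the
  two sides is \<open>((1 - \<theta> w) x - c)\<^sup>2 / w + v \<theta>\<^sup>2 (w - u)\<^sup>2 / w + (r - 1 - ln r)\<close>, a sum of nonnegative
  terms.\<close>

lemma (in tilt) tilt_affine_le_J_S: "ereal (tilt_affine \<theta> w c q) \<le> J_S \<theta> q"
proof (cases q)
  case (Pair x y)
  show ?thesis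
  proof (cases "y > x\<^sup>2")
    case False
    then show ?thesis
      using Pair by (simp add: J_S_infinity)
  next
    case True
    define v where "v = y - x\<^sup>2"
    have v: "v > 0" using True by (simp add: v_def)
    from variance_parameter[OF v, of \<theta>] obtain u where
      u: "0 < u" "\<bar>\<theta>\<bar> * u < 1" "u = v * (1 - \<theta>\<^sup>2 * u\<^sup>2)" 
        "sqrt (1 + 4 * \<theta>\<^sup>2 * v\<^sup>2) = 1 + 2 * \<theta>\<^sup>2 * u * v"
        "2 * v / (1 + sqrt (1 + 4 * \<theta>\<^sup>2 * v\<^sup>2)) = u" .
    have "ln u - ln w = ln (u / w)"
      using u w_pos by (simp add: ln_div)
    also have "\<dots> \<le> u / w - 1"
      using u w_pos by (intro ln_le_minus_one) simp
    also have "u / w = v * (1 - \<theta>\<^sup>2 * u\<^sup>2) / w"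
      using u(3) by simp
    finally have ln: "ln u - ln w \<le> v * (1 - \<theta>\<^sup>2 * u\<^sup>2) / w - 1" .
    define E1 E2 where "E1 = ((1 - \<theta> * w) * x - c)\<^sup>2 / w" and "E2 = v * \<theta>\<^sup>2 * (w - u)\<^sup>2 / w"
    define A B where "A = v * (\<theta>\<^sup>2 * w + 1 / w)" and "B = v * (1 - \<theta>\<^sup>2 * u\<^sup>2) / w"
    define H where "H = 2 * \<theta>\<^sup>2 * u * v"
    define F G where "F = x\<^sup>2 * (1 - \<theta>)\<^sup>2" and "G = v * (1 + \<theta>\<^sup>2)"
    have "0 \<le> E1" "0 \<le> E2"
      using w_pos v by (simp_all add: E1_def E2_def)
    moreover have "A - H - B = E2"
      using w_pos by (simp add: H_def A_def B_def E2_def field_simps power2_eq_square)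
    moreover have y: "y * (1 + \<theta>\<^sup>2) - 2 * x\<^sup>2 * \<theta> = F + G"
      by (simp add: F_def G_def v_def power2_eq_square algebra_simps)
    moreover have v': "v * (1 + \<theta>\<^sup>2 - \<theta>\<^sup>2 * w - 1 / w) = G - A"
      by (simp add: A_def G_def algebra_simps)
    ultimately have "tilt_affine \<theta> w c (x, y) \<le>
        (y * (1 + \<theta>\<^sup>2) - 2 * x\<^sup>2 * \<theta> - (1 + 2 * \<theta>\<^sup>2 * u * v) - ln u) / 2"
      using ln unfolding tilt_affine_eq v_def[symmetric] v' y B_def[symmetric] E1_def[symmetric] F_def[symmetric] H_def[symmetric]
      by simp
    then show ?thesis
      using J_S_variance[OF True, of \<theta> u] u(4,5) Pair by (simp add: v_def)
  qed
qed

text \<open>All three terms of the difference in \<open>tilt_affine_le_J_S\<close> vanish for \<open>w = u\<close> and \<open>c = (1 - \<theta> w) x\<close>.\<close>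

lemma J_S_eq_tilt_affine:
  assumes "\<bar>\<theta>\<bar> < 1" "y > x\<^sup>2"
  obtains w where "tilt \<theta> w" "y = x\<^sup>2 + w / (1 - (\<theta> * w)\<^sup>2)"
    "J_S \<theta> (x, y) = ereal (tilt_affine \<theta> w ((1 - \<theta> * w) * x) (x, y))"
proof -
  define v where "v = y - x\<^sup>2"
  have v: "v > 0" using assms by (simp add: v_def)
  from variance_parameter[OF v, of \<theta>] obtain w where
    w: "0 < w" "\<bar>\<theta>\<bar> * w < 1" "w = v * (1 - \<theta>\<^sup>2 * w\<^sup>2)" 
      "sqrt (1 + 4 * \<theta>\<^sup>2 * v\<^sup>2) = 1 + 2 * \<theta>\<^sup>2 * w * v"
      "2 * v / (1 + sqrt (1 + 4 * \<theta>\<^sup>2 * v\<^sup>2)) = w" .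
  interpret tilt \<theta> w "(1 - \<theta> * w) * x"
    using w assms by unfold_locales auto
  have v_eq: "v = w / (1 - (\<theta> * w)\<^sup>2)"
    using w(3) phi_square_less_1 by (simp add: field_simps)
  have "1 = v * (1 - \<theta>\<^sup>2 * w\<^sup>2) / w"
    using w(1,3) by simp
  then have 1: "v / w = 1 + \<theta>\<^sup>2 * w * v"
    using w(1) by (simp add: field_simps power2_eq_square)
  have 2: "y * (1 + \<theta>\<^sup>2) - 2 * x\<^sup>2 * \<theta> = x\<^sup>2 * (1 - \<theta>)\<^sup>2 + v * (1 + \<theta>\<^sup>2)"
    by (simp add: v_def power2_eq_square algebra_simps)
  have 3: "v * (1 + \<theta>\<^sup>2 - \<theta>\<^sup>2 * w - 1 / w) = v * (1 + \<theta>\<^sup>2) - \<theta>\<^sup>2 * w * v - v / w"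
    by (simp add: algebra_simps)
  have "J_S \<theta> (x, y) = ereal (tilt_affine \<theta> w ((1 - \<theta> * w) * x) (x, y))"
    using J_S_variance[OF assms(2), of \<theta> w] w(4,5)
    unfolding tilt_affine_eq v_def[symmetric] by (simp add: 2 3 1)
  with v_eq show ?thesis
    by (intro that[of w]) (auto simp: v_def tilt_axioms)
qed

text \<open>If \<open>y \<le> x\<^sup>2\<close>, the stationary mean is kept equal to \<open>x\<close> and \<open>w\<close> tends to \<open>0\<close>: then the multiplier of
  the sum of squares is negative and the term \<open>- ln w / 2\<close> is unbounded.\<close>

lemma less_J_S_imp_less_tilt_affine:
  assumes "\<bar>\<theta>\<bar> < 1" "ereal \<alpha> < J_S \<theta> p"
  obtains w c where "tilt \<theta> w" "\<alpha> < tilt_affine \<theta> w c p"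
proof (cases p)
  case (Pair x y)
  show ?thesis
  proof (cases "y > x\<^sup>2")
    case True
    show ?thesis
      using J_S_eq_tilt_affine[OF assms(1) True] assms(2) that unfolding Pair
      by (metis less_ereal.simps(1))
  next
    case False
    \<comment> \<open>\<open>w \<le> 1 / 2\<close> makes \<open>1 / w \<ge> 2 > 1 + \<theta>\<^sup>2\<close>, and the second bound makes \<open>- ln w > 2 \<alpha>\<close>.\<close>
    define w where "w = min (1 / 2) (exp (- 2 * \<alpha> - 1))"
    have w: "0 < w" "w \<le> 1 / 2"
      by (auto simp: w_def)
    have "\<bar>\<theta>\<bar> * w \<le> 1 * (1/2)"
      using assms w by (intro mult_mono) auto
    then interpret tilt \<theta> w "(1 - \<theta> * w) * x"
      using w assms by unfold_locales auto
    have "ln w \<le> ln (exp (- 2 * \<alpha> - 1))"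
      using w by (subst ln_le_cancel_iff) (auto simp: w_def)
    then have ln: "2 * \<alpha> < - ln w" by simp
    have "1 + \<theta>\<^sup>2 - \<theta>\<^sup>2 * w - 1 / w \<le> 0"
    proof -
      have "1 / w \<ge> 2" using w by (simp add: field_simps)
      moreover have "0 \<le> \<theta>\<^sup>2 * w" using w by simp
      ultimately show ?thesis using theta_square_less_1 by linarith
    qed
    then have "0 \<le> (y - x\<^sup>2) * (1 + \<theta>\<^sup>2 - \<theta>\<^sup>2 * w - 1 / w)"
      using False by (intro mult_nonpos_nonpos) auto
    moreover have "0 \<le> x\<^sup>2 * (1 - \<theta>)\<^sup>2" by simp
    moreover have "2 * tilt_affine \<theta> w ((1 - \<theta> * w) * x) p =
       x\<^sup>2 * (1 - \<theta>)\<^sup>2 + (y - x\<^sup>2) * (1 + \<theta>\<^sup>2 - \<theta>\<^sup>2 * w - 1 / w) - ln w"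
      unfolding Pair tilt_affine_eq by simp
    ultimately have "\<alpha> < tilt_affine \<theta> w ((1 - \<theta> * w) * x) p"
      using ln by linarith
    then show ?thesis
      by (rule that[OF tilt_axioms])
  qed
qed

lemma J_S_nonneg: "\<bar>\<theta>\<bar> < 1 \<Longrightarrow> 0 \<le> J_S \<theta> p"
proof -
  assume "\<bar>\<theta>\<bar> < 1"
  then interpret tilt \<theta> 1 0
    by unfold_locales auto
  have "tilt_affine \<theta> 1 0 p = 0"
    by (cases p) (simp add: tilt_affine_def tilt_lam_def tilt_mu_def tilt_Lam_def)
  then show ?thesis
    using tilt_affine_le_J_S[of p] by (simp add: zero_ereal_def)
qed

lemma J_S_superlevel_open:
  assumes "\<bar>\<theta>\<bar> < 1"
  shows "open {p. ereal \<alpha> < J_S \<theta> p}"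
proof -
  have "{p. ereal \<alpha> < J_S \<theta> p} = (\<Union>(w, c) \<in> {(w, c). tilt \<theta> w}. {p. \<alpha> < tilt_affine \<theta> w c p})"
  proof (intro equalityI subsetI)
    fix p assume "p \<in> {p. ereal \<alpha> < J_S \<theta> p}"
    then show "p \<in> (\<Union>(w, c) \<in> {(w, c). tilt \<theta> w}. {p. \<alpha> < tilt_affine \<theta> w c p})"
      using less_J_S_imp_less_tilt_affine[OF assms, of \<alpha> p] by simp blast
  next
    fix p assume "p \<in> (\<Union>(w, c) \<in> {(w, c). tilt \<theta> w}. {p. \<alpha> < tilt_affine \<theta> w c p})"
    then obtain w c where "tilt \<theta> w" "\<alpha> < tilt_affine \<theta> w c p"
      by auto
    then show "p \<in> {p. ereal \<alpha> < J_S \<theta> p}"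
      using tilt.tilt_affine_le_J_S[of \<theta> w c p]
      by (simp add: less_le_trans[of "ereal \<alpha>" "ereal (tilt_affine \<theta> w c p)"])
  qed
  moreover have "open {p. \<alpha> < tilt_affine \<theta> w c p}" for w c
    by (intro open_Collect_less continuous_intros)
  ultimately show ?thesis
    by auto
qed

lemma J_S_lower_semicontinuous:
  assumes "\<bar>\<theta>\<bar> < 1"
  shows "lower_semicontinuous (J_S \<theta>)"
  unfolding lower_semicontinuous_def
proof
  fix p
  show "J_S \<theta> p \<le> Liminf (nhds p) (J_S \<theta>)"
  proof (rule dense_le)
    fix a assume a: "a < J_S \<theta> p"
    show "a \<le> Liminf (nhds p) (J_S \<theta>)"
    proof (cases a)
      case (real \<alpha>)
      then have "eventually (\<lambda>q. q \<in> {q. ereal \<alpha> < J_S \<theta> q}) (nhds p)"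
        using a J_S_superlevel_open[OF assms] by (intro eventually_nhds_in_open) auto
      then show ?thesis
        unfolding real by (intro Liminf_bounded) (auto elim: eventually_mono)
    qed (use a in auto)
  qed
qed

text \<open>The multiplier of the sum of squares vanishes at \<open>w = 1\<close> and equals \<open>(w - 1) (1 / w - \<theta>\<^sup>2) / 2\<close>, so a
  value of \<open>w\<close> between \<open>1\<close> and \<open>1 / \<bar>\<theta>\<bar>\<close> serves. Tilts of this kind control large sums of squares.\<close>

lemma positive_mu_tilt:
  assumes "\<bar>\<theta>\<bar> < 1"
  obtains w where "tilt \<theta> w" "0 < tilt_mu \<theta> w"
proof -
  define w where "w = 2 / (1 + \<bar>\<theta>\<bar>)"
  have w1: "1 < w" using assms by (simp add: w_def)
  have tw: "\<bar>\<theta>\<bar> * w < 1" using assms by (simp add: w_def field_simps)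
  interpret tilt \<theta> w 0
    using assms w1 tw by unfold_locales auto
  have "0 < (w - 1) * (1 / w - \<theta>\<^sup>2)"
    using w1 theta_square_w_less_1 by (intro mult_pos_pos) (auto simp: field_simps)
  also have "\<dots> = 2 * tilt_mu \<theta> w"
    using w1 by (simp add: tilt_mu_def field_simps)
  finally show ?thesis
    using that tilt_axioms by simp
qed

lemma compact_parabola_cap: "compact {p :: real \<times> real. (fst p)\<^sup>2 \<le> snd p \<and> snd p \<le> R}"
proof -
  have "{p :: real \<times> real. (fst p)\<^sup>2 \<le> snd p \<and> snd p \<le> R} \<subseteq> cbox (- (\<bar>R\<bar> + 1), 0) (\<bar>R\<bar> + 1, \<bar>R\<bar>)"
  proof
    fix p :: "real \<times> real"
    assume p: "p \<in> {p. (fst p)\<^sup>2 \<le> snd p \<and> snd p \<le> R}"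
    have "0 \<le> (\<bar>fst p\<bar> - 1 / 2)\<^sup>2" by simp
    then have "\<bar>fst p\<bar> \<le> (fst p)\<^sup>2 + 1 / 4"
      by (simp add: power2_diff power_divide)
    moreover have "0 \<le> (fst p)\<^sup>2" by simp
    ultimately show "p \<in> cbox (- (\<bar>R\<bar> + 1), 0) (\<bar>R\<bar> + 1, \<bar>R\<bar>)"
      using p by (cases p) (auto simp: cbox_Pair_eq intro: order_trans[OF zero_le_power2])
  qed
  then have "bounded {p :: real \<times> real. (fst p)\<^sup>2 \<le> snd p \<and> snd p \<le> R}"
    using bounded_cbox bounded_subset by blast
  moreover have "closed {p :: real \<times> real. (fst p)\<^sup>2 \<le> snd p \<and> snd p \<le> R}"
    by (intro closed_Collect_conj closed_Collect_le continuous_intros)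
  ultimately show ?thesis
    by (simp add: compact_eq_bounded_closed)
qed

lemma J_S_good:
  assumes "\<bar>\<theta>\<bar> < 1"
  shows "good_rate_function (J_S \<theta>)"
  unfolding good_rate_function_def
proof
  fix b
  obtain w where "tilt \<theta> w" and mu: "0 < tilt_mu \<theta> w"
    using positive_mu_tilt[OF assms] .
  then interpret tilt \<theta> w 0 by simp
  define R where "R = (b + tilt_Lam w 0) / tilt_mu \<theta> w"
  have eq: "J_S \<theta> -` {0..ereal b} = - {p. ereal b < J_S \<theta> p}"
    using J_S_nonneg[OF assms] by (auto simp: not_less)
  have "closed (J_S \<theta> -` {0..ereal b})"
    unfolding eq using J_S_superlevel_open[OF assms] by (simp add: closed_Compl)
  moreover have "J_S \<theta> -` {0..ereal b} \<subseteq> {p. (fst p)\<^sup>2 \<le> snd p \<and> snd p \<le> R}"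
  proof clarify
    fix x y assume p: "J_S \<theta> (x, y) \<in> {0..ereal b}"
    then have "ereal (tilt_affine \<theta> w 0 (x, y)) \<le> ereal b"
      using tilt_affine_le_J_S[of "(x, y)"] by (meson atLeastAtMost_iff order_trans)
    then have "y * tilt_mu \<theta> w \<le> b + tilt_Lam w 0"
      by (simp add: tilt_affine_def tilt_lam_def mult.commute)
    then have "y \<le> R"
      using mu by (simp add: R_def pos_le_divide_eq)
    moreover have "x\<^sup>2 \<le> y"
      using p J_S_infinity[of y x \<theta>] by (cases "x\<^sup>2 \<le> y") auto
    ultimately show "(fst (x, y))\<^sup>2 \<le> snd (x, y) \<and> snd (x, y) \<le> R"
      by simp
  qed
  ultimately show "compact (J_S \<theta> -` {0..ereal b})"
    using closed_Int_compact[OF _ compact_parabola_cap[of R], of "J_S \<theta> -` {0..ereal b}"]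
    by (simp only: Int_absorb2)
qed

section \<open>Weak law of large numbers for the tilted chain\<close>

context tilt
begin

definition "mean = c / (1 - \<theta> * w)"
definition "var = w / (1 - (\<theta> * w)\<^sup>2)"

text \<open>Written with the deviations \<open>z\<^sub>k\<close> of the observations from their mean, this is
  \<open>(1 - \<phi>) \<Sum>z\<^sub>k + z\<^sub>n\<^sub>+\<^sub>1\<close> with \<open>\<phi> = \<theta> w\<close>, where the sum omits the last observation; since
  \<open>z\<^sub>k\<^sub>+\<^sub>1 = \<phi> z\<^sub>k + sqrt w \<cdot> e\<close>, its increments are \<open>sqrt w \<cdot> e\<close>.\<close>

definition linear_mart :: "nat \<Rightarrow> real \<times> real \<times> real \<Rightarrow> real" where
  "linear_mart n = (\<lambda>(x, s, t). (1 - \<theta> * w) * (s - x - real n * mean) + (x - mean))"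

text \<open>Likewise \<open>(1 - \<phi>\<^sup>2) \<Sum>(z\<^sub>k\<^sup>2 - var) + z\<^sub>n\<^sub>+\<^sub>1\<^sup>2\<close>, where again the sum omits the last
  observation. The increments are \<open>2 \<phi> sqrt w \<cdot> z\<^sub>k e + w (e\<^sup>2 - 1)\<close>.\<close>

definition square_mart :: "nat \<Rightarrow> real \<times> real \<times> real \<Rightarrow> real" where
  "square_mart n = (\<lambda>(x, s, t). (1 - (\<theta> * w)\<^sup>2) *
     (t - 2 * mean * s + real (Suc n) * mean\<^sup>2 - (x - mean)\<^sup>2 - real n * var) + (x - mean)\<^sup>2)"

lemma linear_mart_measurable [measurable]: "linear_mart n \<in> borel_measurable borel"
  unfolding linear_mart_def case_prod_beta by measurable

lemma square_mart_measurable [measurable]: "square_mart n \<in> borel_measurable borel"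
  unfolding square_mart_def case_prod_beta by measurable

lemma mean_eq: "(1 - \<theta> * w) * mean = c"
  using abs_phi_less_1 by (simp add: mean_def)

lemma phi_sq_less_1: "(\<theta> * w)\<^sup>2 < 1"
  using abs_phi_less_1 by (simp add: abs_square_less_1)

lemma var_eq: "(1 - (\<theta> * w)\<^sup>2) * var = w"
  using phi_sq_less_1 by (simp add: var_def)

lemma var_pos: "0 < var"
  using phi_sq_less_1 w_pos by (simp add: var_def)

lemma deviation_step:
  "fst (chain_step (\<theta> * w * fst z + c + sqrt w * e) z) - mean = \<theta> * w * (fst z - mean) + sqrt w * e + 0 * (e\<^sup>2 - 1)"
  using mean_eq by (simp add: chain_step_def case_prod_beta algebra_simps)

lemma linear_mart_step:
  "linear_mart (Suc n) (chain_step (\<theta> * w * fst z + c + sqrt w * e) z) =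
     linear_mart n z + sqrt w * e + 0 * (e\<^sup>2 - 1)"
  using mean_eq by (simp add: linear_mart_def chain_step_def case_prod_beta algebra_simps)

lemma square_mart_step:
  "square_mart (Suc n) (chain_step (\<theta> * w * fst z + c + sqrt w * e) z) =
     square_mart n z + 2 * (\<theta> * w) * sqrt w * (fst z - mean) * e + w * (e\<^sup>2 - 1)"
proof -
  obtain x s t where z: "z = (x, s, t)" by (cases z) auto
  define y where "y = \<theta> * w * x + c + sqrt w * e"
  have y: "(y - mean)\<^sup>2 = (\<theta> * w)\<^sup>2 * (x - mean)\<^sup>2 + 2 * (\<theta> * w) * sqrt w * (x - mean) * e + w * e\<^sup>2"
  proof -
    have "y - mean = \<theta> * w * (x - mean) + sqrt w * e"
      using mean_eq by (simp add: y_def algebra_simps)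
    moreover have "w * e\<^sup>2 = (sqrt w * e)\<^sup>2"
      using w_pos by (simp add: power_mult_distrib)
    ultimately show ?thesis
      by (simp only: power2_sum power_mult_distrib) (simp add: algebra_simps)
  qed
  have "square_mart (Suc n) (chain_step y z) =
     (1 - (\<theta> * w)\<^sup>2) * (t - 2 * mean * s + real (Suc n) * mean\<^sup>2 - real n * var) - (1 - (\<theta> * w)\<^sup>2) * var + (y - mean)\<^sup>2"
    by (simp add: square_mart_def chain_step_def z power2_eq_square algebra_simps)
  also have "\<dots> = square_mart n z - (1 - (\<theta> * w)\<^sup>2) * var - (\<theta> * w)\<^sup>2 * (x - mean)\<^sup>2 + (y - mean)\<^sup>2"
    by (simp add: square_mart_def z algebra_simps)
  finally show ?thesis
    unfolding var_eq y by (simp add: y_def z algebra_simps)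
qed

text \<open>The initial law integrates \<open>exp (\<kappa> x\<^sup>2 / 2)\<close>, which dominates every polynomial.\<close>

lemma initial_polynomial_moments:
  obtains B where "0 \<le> B" "(\<integral>\<^sup>+x. ennreal ((x - mean)\<^sup>2) \<partial>\<nu>) \<le> ennreal B"
    "(\<integral>\<^sup>+x. ennreal (((x - mean)\<^sup>2)\<^sup>2) \<partial>\<nu>) \<le> ennreal B"
proof -
  obtain \<kappa> where \<kappa>: "0 < \<kappa>" "\<kappa> < 1 / w - \<theta>\<^sup>2"
    using exists_lyapunov_exponent by blast
  obtain B where B: "(\<integral>\<^sup>+x. ennreal (exp (\<kappa> / 2 * x\<^sup>2)) \<partial>\<nu>) = ennreal B" "0 \<le> B"
    using nn_integral_exp_square_initial[OF \<kappa>(2)] by (metis less_irrefl ennreal_cases infinity_ennreal_def)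
  obtain M where M: "emeasure \<nu> UNIV = ennreal M" "0 \<le> M"
    using emeasure_initial_finite by (metis less_irrefl ennreal_cases infinity_ennreal_def)
  \<comment> \<open>Small enough for \<open>exp (4 a (x - mean)\<^sup>2)\<close> to be dominated by \<open>exp (\<kappa> x\<^sup>2 / 2)\<close>.\<close>
  define a where "a = \<kappa> / 16"
  have a: "0 < a" "4 * a < \<kappa> / 2" using \<kappa> by (simp_all add: a_def)
  define L where "L = max (1 / (2 * a)) (1 / (2 * a)\<^sup>2)"
  have L: "L > 0" using a by (simp add: L_def less_max_iff_disj)
  obtain K where K: "0 \<le> K" "\<And>x. exp (4 * a * x\<^sup>2 + (- 8 * a * mean) * x + 4 * a * mean\<^sup>2) \<le> 1 * exp (\<kappa> / 2 * x\<^sup>2) + K"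
    using exp_quadratic_le[OF a(2), of 1] by (metis zero_less_one)
  have dom: "u \<le> L * exp (4 * a * u)" "u\<^sup>2 \<le> L * exp (4 * a * u)" if "0 \<le> u" for u :: real
  proof -
    have e: "2 * a * u \<le> exp (2 * a * u)"
      using exp_ge_add_one_self[of "2 * a * u"] by linarith
    also have "exp (2 * a * u) \<le> exp (4 * a * u)"
      using a that by simp
    finally have "u * (2 * a) \<le> exp (4 * a * u)"
      by (simp only: mult_ac)
    then have "u \<le> 1 / (2 * a) * exp (4 * a * u)"
      using a by (simp add: pos_le_divide_eq)
    also have "\<dots> \<le> L * exp (4 * a * u)"
      by (intro mult_right_mono) (auto simp: L_def)
    finally show "u \<le> L * exp (4 * a * u)" .
    have "(2 * a * u)\<^sup>2 \<le> (exp (2 * a * u))\<^sup>2"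
      using e a that by (intro power_mono) auto
    also have "(exp (2 * a * u))\<^sup>2 = exp (4 * a * u)"
      by (simp add: exp_double[symmetric])
    finally have "u\<^sup>2 \<le> 1 / (2 * a)\<^sup>2 * exp (4 * a * u)"
      using a by (simp add: field_simps)
    also have "\<dots> \<le> L * exp (4 * a * u)"
      by (intro mult_right_mono) (auto simp: L_def)
    finally show "u\<^sup>2 \<le> L * exp (4 * a * u)" .
  qed
  have ex: "L * exp (4 * a * (x - mean)\<^sup>2) \<le> L * (exp (\<kappa> / 2 * x\<^sup>2) + K)" for x
  proof -
    have "4 * a * (x - mean)\<^sup>2 = 4 * a * x\<^sup>2 + (- 8 * a * mean) * x + 4 * a * mean\<^sup>2"
      by (simp add: power2_eq_square algebra_simps)
    then show ?thesis
      using K(2)[of x] L by simp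
  qed
  have int: "(\<integral>\<^sup>+x. ennreal (g x) \<partial>\<nu>) \<le> ennreal (L * (B + K * M))"
    if "\<And>x. g x \<le> L * exp (4 * a * (x - mean)\<^sup>2)" for g
  proof -
    have "(\<integral>\<^sup>+x. ennreal (g x) \<partial>\<nu>) \<le> (\<integral>\<^sup>+x. ennreal L * (ennreal (exp (\<kappa> / 2 * x\<^sup>2)) + ennreal K) \<partial>\<nu>)"
    proof (rule nn_integral_mono)
      fix x
      have "ennreal (g x) \<le> ennreal (L * (exp (\<kappa> / 2 * x\<^sup>2) + K))"
        using order_trans[OF that ex] by (rule ennreal_leI)
      also have "\<dots> = ennreal L * (ennreal (exp (\<kappa> / 2 * x\<^sup>2)) + ennreal K)"
        using L K by (simp add: ennreal_mult)
      finally show "ennreal (g x) \<le> \<dots>" .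
    qed
    also have "\<dots> = ennreal L * (ennreal B + ennreal K * ennreal M)"
      unfolding B(1)[symmetric] M(1)[symmetric]
      by (subst nn_integral_cmult, measurable, subst nn_integral_add) auto
    also have "\<dots> = ennreal (L * (B + K * M))"
      using L B K M by (simp add: ennreal_mult)
    finally show ?thesis .
  qed
  show ?thesis
  proof (rule that[of "L * (B + K * M)"])
    show "0 \<le> L * (B + K * M)"
      using L B K M by simp
    show "(\<integral>\<^sup>+x. ennreal ((x - mean)\<^sup>2) \<partial>\<nu>) \<le> ennreal (L * (B + K * M))"
      by (intro int dom(1)) simp
    show "(\<integral>\<^sup>+x. ennreal (((x - mean)\<^sup>2)\<^sup>2) \<partial>\<nu>) \<le> ennreal (L * (B + K * M))"
      by (intro int dom(2)) simp
  qed
qed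

text \<open>The second moment about the mean obeys a contracting recursion; it bounds the second moments
  of the martingale increments, which therefore add up to linear growth.\<close>

lemma tilted_moments:
  obtains C where "0 \<le> C" "\<And>n. (\<integral>\<^sup>+z. ennreal ((fst z - mean)\<^sup>2) \<partial>Q n) \<le> ennreal C"
    "\<And>n. (\<integral>\<^sup>+z. ennreal ((linear_mart n z)\<^sup>2) \<partial>Q n) \<le> ennreal (C * real (Suc n))"
    "\<And>n. (\<integral>\<^sup>+z. ennreal ((square_mart n z)\<^sup>2) \<partial>Q n) \<le> ennreal (C * real (Suc n))"
proof -
  obtain B where B: "0 \<le> B" "(\<integral>\<^sup>+x. ennreal ((x - mean)\<^sup>2) \<partial>\<nu>) \<le> ennreal B"
    "(\<integral>\<^sup>+x. ennreal (((x - mean)\<^sup>2)\<^sup>2) \<partial>\<nu>) \<le> ennreal B"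
    using initial_polynomial_moments .
  obtain M where M: "emeasure \<nu> UNIV = ennreal M" "0 \<le> M"
    using emeasure_initial_finite by (metis less_irrefl ennreal_cases infinity_ennreal_def)
  have step: "(\<integral>\<^sup>+z. ennreal ((F' z)\<^sup>2) \<partial>Q (Suc n)) = (\<integral>\<^sup>+z. ennreal ((F z)\<^sup>2 + (G z)\<^sup>2 + 2 * d\<^sup>2) \<partial>Q n)"
    if [measurable]: "F' \<in> borel_measurable borel"
      and "\<And>z e. F' (chain_step (\<theta> * w * fst z + c + sqrt w * e) z) = F z + G z * e + d * (e\<^sup>2 - 1)"
    for F F' G d n
    by (subst nn_integral_chain_Suc) (simp_all add: that(2) std_normal_second_moment)
  define D where "D = (\<lambda>n. \<integral>\<^sup>+z. ennreal ((fst z - mean)\<^sup>2) \<partial>Q n)"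
  have D0: "D 0 \<le> ennreal B"
    unfolding D_def using B by (subst nn_integral_chain_0) auto
  have "D (Suc n) = ennreal ((\<theta> * w)\<^sup>2) * D n + ennreal (w * M)" for n
  proof -
    have "D (Suc n) = (\<integral>\<^sup>+z. ennreal ((\<theta> * w * (fst z - mean))\<^sup>2 + (sqrt w)\<^sup>2 + 2 * 0\<^sup>2) \<partial>Q n)"
      unfolding D_def by (rule step[OF _ deviation_step]) measurable
    also have "\<dots> = (\<integral>\<^sup>+z. ennreal ((\<theta> * w)\<^sup>2) * ennreal ((fst z - mean)\<^sup>2) + ennreal w \<partial>Q n)"
      using w_pos by (intro nn_integral_cong) (simp add: power_mult_distrib ennreal_mult)
    also have "\<dots> = ennreal ((\<theta> * w)\<^sup>2) * D n + ennreal (w * M)"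
      unfolding D_def using M w_pos
      by (subst nn_integral_add) (auto simp: nn_integral_cmult emeasure_chain ennreal_mult)
    finally show ?thesis .
  qed
  moreover have "D 0 < \<infinity>"
    using D0 by (rule le_less_trans) simp
  ultimately obtain C where C: "0 \<le> C" "\<And>n. D n \<le> ennreal C"
    using affine_recursion_bounded[of "(\<theta> * w)\<^sup>2" "w * M" D] phi_sq_less_1 w_pos M by auto
  define E where "E = B + C + w * M + 4 * (\<theta> * w)\<^sup>2 * w * C + 2 * w\<^sup>2 * M"
  have E: "B \<le> E" "C \<le> E" "w * M \<le> E" "4 * (\<theta> * w)\<^sup>2 * w * C + 2 * w\<^sup>2 * M \<le> E" "0 \<le> E"
    using B C M w_pos unfolding E_def by (auto intro!: add_nonneg_nonneg add_increasing add_increasing2)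
  have lin: "(\<integral>\<^sup>+z. ennreal ((linear_mart n z)\<^sup>2) \<partial>Q n) \<le> ennreal (E * real (Suc n))" for n
  proof (induction n)
    case 0
    have "(\<integral>\<^sup>+z. ennreal ((linear_mart 0 z)\<^sup>2) \<partial>Q 0) \<le> ennreal B"
      using B by (subst nn_integral_chain_0) (auto simp: linear_mart_def)
    also have "\<dots> \<le> ennreal (E * real (Suc 0))"
      using E by (intro ennreal_leI) simp
    finally show ?case .
  next
    case (Suc n)
    have "(\<integral>\<^sup>+z. ennreal ((linear_mart (Suc n) z)\<^sup>2) \<partial>Q (Suc n)) =
       (\<integral>\<^sup>+z. ennreal ((linear_mart n z)\<^sup>2 + (sqrt w)\<^sup>2 + 2 * 0\<^sup>2) \<partial>Q n)"
      by (rule step[OF _ linear_mart_step]) measurable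
    also have "\<dots> = (\<integral>\<^sup>+z. ennreal ((linear_mart n z)\<^sup>2) + ennreal w \<partial>Q n)"
      using w_pos by (intro nn_integral_cong) simp
    also have "\<dots> = (\<integral>\<^sup>+z. ennreal ((linear_mart n z)\<^sup>2) \<partial>Q n) + ennreal (w * M)"
      using M w_pos by (subst nn_integral_add) (auto simp: emeasure_chain ennreal_mult)
    also have "\<dots> \<le> ennreal (E * real (Suc n)) + ennreal E"
      using E by (intro add_mono Suc ennreal_leI)
    also have "\<dots> = ennreal (E * real (Suc (Suc n)))"
      using E by (simp add: ennreal_plus[symmetric] algebra_simps del: ennreal_plus)
    finally show ?case .
  qed
  have sq: "(\<integral>\<^sup>+z. ennreal ((square_mart n z)\<^sup>2) \<partial>Q n) \<le> ennreal (E * real (Suc n))" for n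
  proof (induction n)
    case 0
    have "square_mart 0 (x, x, x\<^sup>2) = (x - mean)\<^sup>2" for x
      by (simp add: square_mart_def power2_eq_square algebra_simps)
    then have "(\<integral>\<^sup>+z. ennreal ((square_mart 0 z)\<^sup>2) \<partial>Q 0) \<le> ennreal B"
      using B by (subst nn_integral_chain_0) auto
    also have "\<dots> \<le> ennreal (E * real (Suc 0))"
      using E by (intro ennreal_leI) simp
    finally show ?case .
  next
    case (Suc n)
    have "(\<integral>\<^sup>+z. ennreal ((square_mart (Suc n) z)\<^sup>2) \<partial>Q (Suc n)) =
       (\<integral>\<^sup>+z. ennreal ((square_mart n z)\<^sup>2 + (2 * (\<theta> * w) * sqrt w * (fst z - mean))\<^sup>2 + 2 * w\<^sup>2) \<partial>Q n)"
      by (rule step[OF _ square_mart_step]) measurable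
    also have "\<dots> = (\<integral>\<^sup>+z. ennreal ((square_mart n z)\<^sup>2) +
         (ennreal (4 * (\<theta> * w)\<^sup>2 * w) * ennreal ((fst z - mean)\<^sup>2) + ennreal (2 * w\<^sup>2)) \<partial>Q n)"
      using w_pos by (intro nn_integral_cong)
        (simp add: power_mult_distrib ennreal_mult[symmetric] ennreal_plus[symmetric] add.assoc del: ennreal_plus)
    also have "\<dots> = (\<integral>\<^sup>+z. ennreal ((square_mart n z)\<^sup>2) \<partial>Q n) +
         (ennreal (4 * (\<theta> * w)\<^sup>2 * w) * D n + ennreal (2 * w\<^sup>2) * ennreal M)"
      unfolding D_def using M w_pos
      by (subst nn_integral_add, measurable, subst nn_integral_add)
         (auto simp: nn_integral_cmult emeasure_chain)
    also have "\<dots> \<le> ennreal (E * real (Suc n)) + (ennreal (4 * (\<theta> * w)\<^sup>2 * w) * ennreal C + ennreal (2 * w\<^sup>2) * ennreal M)"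
      by (intro add_mono Suc mult_left_mono C order_refl) simp
    also have "\<dots> = ennreal (E * real (Suc n) + (4 * (\<theta> * w)\<^sup>2 * w * C + 2 * w\<^sup>2 * M))"
      using w_pos C M E by (simp add: ennreal_mult[symmetric] ennreal_plus[symmetric] del: ennreal_plus)
    also have "\<dots> \<le> ennreal (E * real (Suc (Suc n)))"
      using E by (intro ennreal_leI) (simp add: algebra_simps)
    finally show ?case .
  qed
  have "D n \<le> ennreal E" for n
    using C(2)[of n] E(2) by (meson ennreal_leI order_trans)
  then show ?thesis
    using that[OF E(5) _ lin sq] by (simp add: D_def)
qed

lemma finite_measure_Q: "finite_measure (Q n)"
  using emeasure_initial_finite by (intro finite_measureI) (simp add: emeasure_chain)

text \<open>The last observation is kept bounded because the endpoint factor has to be bounded when the measure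
  is changed back.\<close>

lemma weak_law_event:
  assumes "\<delta> > 0"
  obtains R \<eta> n0 where "R > 0" "\<eta> > 0"
    "\<And>n. n \<ge> n0 \<Longrightarrow> \<eta> \<le> measure (Q n) {z. \<bar>fst z - mean\<bar> \<le> R \<and>
       \<bar>linear_mart n z\<bar> \<le> \<delta> * real (Suc n) \<and> \<bar>square_mart n z\<bar> \<le> \<delta> * real (Suc n)}"
proof -
  obtain C where C: "0 \<le> C" "\<And>n. (\<integral>\<^sup>+z. ennreal ((fst z - mean)\<^sup>2) \<partial>Q n) \<le> ennreal C"
    "\<And>n. (\<integral>\<^sup>+z. ennreal ((linear_mart n z)\<^sup>2) \<partial>Q n) \<le> ennreal (C * real (Suc n))"
    "\<And>n. (\<integral>\<^sup>+z. ennreal ((square_mart n z)\<^sup>2) \<partial>Q n) \<le> ennreal (C * real (Suc n))"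
    by (rule tilted_moments) blast
  obtain M where M: "emeasure \<nu> UNIV = ennreal M" "0 < M"
    using emeasure_initial_finite emeasure_initial_pos
    by (metis ennreal_cases ennreal_less_zero_iff infinity_ennreal_def less_irrefl)
  \<comment> \<open>With \<open>M\<close> the total mass, the three exceptional events get mass at most \<open>M / 4\<close>, \<open>M / 8\<close>, \<open>M / 8\<close>.\<close>
  define R where "R = sqrt (4 * (C + 1) / M)"
  have R: "R > 0" "R\<^sup>2 = 4 * (C + 1) / M"
    using C M by (simp_all add: R_def)
  have CR: "C / R\<^sup>2 \<le> M / 4"
    using C M by (simp add: R field_simps)
  define n0 where "n0 = nat \<lceil>8 * C / (\<delta>\<^sup>2 * M)\<rceil>"
  show ?thesis
  proof (rule that[of R "M / 4" n0])
    fix n assume n: "n0 \<le> n"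
    interpret finite_measure "Q n" by (rule finite_measure_Q)
    let ?m = "real (Suc n)"
    have tail: "measure (Q n) {z. r < \<bar>f z\<bar>} \<le> K / r\<^sup>2"
      if [measurable]: "f \<in> borel_measurable borel" and "0 \<le> K" "0 < r"
        and "(\<integral>\<^sup>+z. ennreal ((f z)\<^sup>2) \<partial>Q n) \<le> ennreal K" for f K r
    proof -
      have "emeasure (Q n) {z \<in> space (Q n). r < \<bar>f z\<bar>} \<le> ennreal (K / r\<^sup>2)"
        using that by (intro chebyshev_nn_integral) auto
      then show ?thesis
        using that by (simp add: emeasure_eq_measure)
    qed
    have "8 * C / (\<delta>\<^sup>2 * M) \<le> real n0"
      unfolding n0_def by (rule real_nat_ceiling_ge)
    then have "8 * C / (\<delta>\<^sup>2 * M) \<le> ?m"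
      using n by (simp add: of_nat_mono order_trans[of _ "real n0"])
    then have "8 * C \<le> ?m * (\<delta>\<^sup>2 * M)"
      using assms M by (simp add: pos_divide_le_eq del: of_nat_Suc)
    then have "C / (\<delta>\<^sup>2 * ?m) \<le> M / 8"
      using assms by (simp add: pos_divide_le_eq mult_ac del: of_nat_Suc)
    moreover have "C * ?m / (\<delta> * ?m)\<^sup>2 = C / (\<delta>\<^sup>2 * ?m)"
      by (simp add: power2_eq_square)
    ultimately have Cm: "C * ?m / (\<delta> * ?m)\<^sup>2 \<le> M / 8"
      by simp
    let ?A = "{z. \<bar>fst z - mean\<bar> \<le> R \<and> \<bar>linear_mart n z\<bar> \<le> \<delta> * ?m \<and> \<bar>square_mart n z\<bar> \<le> \<delta> * ?m}"
    let ?B1 = "{z. R < \<bar>fst z - mean\<bar>}" and ?B2 = "{z. \<delta> * ?m < \<bar>linear_mart n z\<bar>}"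
      and ?B3 = "{z. \<delta> * ?m < \<bar>square_mart n z\<bar>}"
    have [measurable]: "?A \<in> sets borel" "?B1 \<in> sets borel" "?B2 \<in> sets borel" "?B3 \<in> sets borel"
      by (simp_all add: borel_open open_Collect_less continuous_intros)
    have "M = measure (Q n) UNIV"
      using M by (simp add: measure_def emeasure_chain)
    also have "UNIV = ?A \<union> (?B1 \<union> (?B2 \<union> ?B3))"
      by auto
    also have "measure (Q n) \<dots> \<le> measure (Q n) ?A + (measure (Q n) ?B1 + (measure (Q n) ?B2 + measure (Q n) ?B3))"
      by (intro order_trans[OF measure_Un_le] add_left_mono) auto
    also have "\<dots> \<le> measure (Q n) ?A + (M / 4 + (M / 8 + M / 8))"
    proof (intro add_mono order_refl)
      show "measure (Q n) ?B1 \<le> M / 4"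
        using tail[OF _ C(1) R(1) C(2)] by (rule order_trans[OF _ CR]) simp
      show "measure (Q n) ?B2 \<le> M / 8"
        using tail[OF linear_mart_measurable _ _ C(3), of "\<delta> * ?m"] C(1) assms
        by (intro order_trans[OF _ Cm]) simp
      show "measure (Q n) ?B3 \<le> M / 8"
        using tail[OF square_mart_measurable _ _ C(4), of "\<delta> * ?m"] C(1) assms
        by (intro order_trans[OF _ Cm]) simp
    qed
    finally show "M / 4 \<le> measure (Q n) ?A"
      using M by simp
  qed (use R M in auto)
qed

text \<open>Solving the definitions of the two martingales for the empirical moments leaves them as main terms
  and endpoint terms of order \<open>1 / n\<close>.\<close>

lemma empirical_deviation:
  fixes s t x \<delta> R :: real
  assumes "0 < \<delta>" "0 < R" "(R + R\<^sup>2 + var) \<le> \<delta> * real (Suc n)" "\<bar>x - mean\<bar> \<le> R"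
    "\<bar>linear_mart n (x, s, t)\<bar> \<le> \<delta> * real (Suc n)" "\<bar>square_mart n (x, s, t)\<bar> \<le> \<delta> * real (Suc n)"
  shows "dist ((1 / real (Suc n)) *\<^sub>R (s, t)) (mean, mean\<^sup>2 + var) \<le>
    \<delta> * ((1 + 2 * \<bar>mean\<bar>) * (2 / (1 - \<theta> * w)) + 2 / (1 - (\<theta> * w)\<^sup>2))"
proof -
  define m where "m = real (Suc n)"
  have m: "m > 0" by (simp add: m_def)
  define z where "z = x - mean"
  define a b where "a = 1 - \<theta> * w" and "b = 1 - (\<theta> * w)\<^sup>2"
  have a: "a > 0" using abs_phi_less_1 by (simp add: a_def)
  have b: "0 < b" "b \<le> 1" using phi_sq_less_1 by (simp_all add: b_def)
  define d1 where "d1 = s / m - mean"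
  define T where "T = (t - 2 * mean * s) / m + mean\<^sup>2 - var"
  have z: "\<bar>z\<bar> \<le> R" "z\<^sup>2 \<le> R\<^sup>2"
    using assms(2,4) by (auto simp: z_def abs_le_square_iff[symmetric])
  have "R\<^sup>2 \<ge> 0" by simp
  then have Rb: "R \<le> \<delta> * m" "R\<^sup>2 + var \<le> \<delta> * m"
    using assms(2,3) var_pos unfolding m_def by linarith+
  have "a * m * d1 = linear_mart n (x, s, t) - \<theta> * w * z"
    using m by (simp add: a_def d1_def linear_mart_def z_def m_def field_simps)
  moreover have "\<bar>\<theta> * w * z\<bar> \<le> 1 * R"
    unfolding abs_mult[of "\<theta> * w"] using abs_phi_less_1 z by (intro mult_mono) auto
  ultimately have "\<bar>a * m * d1\<bar> \<le> 2 * \<delta> * m"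
    using assms(5) Rb unfolding m_def[symmetric] by linarith
  then have "a * m * \<bar>d1\<bar> \<le> 2 * \<delta> * m"
    using a m by (simp add: abs_mult)
  then have d1: "\<bar>d1\<bar> \<le> \<delta> * (2 / a)"
    using a m by (simp add: field_simps)
  have "b * m * T = square_mart n (x, s, t) - b * var - (\<theta> * w)\<^sup>2 * z\<^sup>2"
  proof -
    have "m * T = t - 2 * mean * s + m * mean\<^sup>2 - m * var"
      using m by (simp add: T_def field_simps)
    then have "b * m * T = b * (t - 2 * mean * s + m * mean\<^sup>2 - m * var)"
      by simp
    also have "\<dots> = square_mart n (x, s, t) - b * var - (\<theta> * w)\<^sup>2 * z\<^sup>2"
      unfolding square_mart_def z_def[symmetric] b_def[symmetric] m_def prod.case
      by (simp add: b_def algebra_simps)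
    finally show ?thesis .
  qed
  moreover have "0 \<le> b * var" "b * var \<le> 1 * var"
    using b var_pos by (auto intro: mult_right_mono simp del: mult_1)
  moreover have "0 \<le> (\<theta> * w)\<^sup>2 * z\<^sup>2" "(\<theta> * w)\<^sup>2 * z\<^sup>2 \<le> 1 * R\<^sup>2"
    using phi_sq_less_1 z mult_mono[of "(\<theta> * w)\<^sup>2" 1 "z\<^sup>2" "R\<^sup>2"] by simp_all
  ultimately have "\<bar>b * m * T\<bar> \<le> 2 * \<delta> * m"
    using assms(6) Rb unfolding m_def[symmetric] by linarith
  then have "b * m * \<bar>T\<bar> \<le> 2 * \<delta> * m"
    using b m by (simp add: abs_mult)
  then have T: "\<bar>T\<bar> \<le> \<delta> * (2 / b)"
    using b m by (simp add: field_simps)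
  have t: "t / m - (mean\<^sup>2 + var) = T + 2 * mean * d1"
    by (simp add: T_def d1_def diff_divide_distrib power2_eq_square algebra_simps)
  have "dist ((1 / m) *\<^sub>R (s, t)) (mean, mean\<^sup>2 + var) \<le> \<bar>d1\<bar> + \<bar>t / m - (mean\<^sup>2 + var)\<bar>"
    using sqrt_sum_squares_le_sum_abs[of d1 "t / m - (mean\<^sup>2 + var)"]
    by (simp add: dist_Pair_Pair dist_real_def d1_def)
  also have "\<dots> \<le> \<bar>d1\<bar> + (\<bar>T\<bar> + 2 * \<bar>mean\<bar> * \<bar>d1\<bar>)"
    unfolding t using abs_triangle_ineq[of T "2 * mean * d1"] by (simp add: abs_mult)
  also have "\<dots> = (1 + 2 * \<bar>mean\<bar>) * \<bar>d1\<bar> + \<bar>T\<bar>"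
    by (simp add: algebra_simps)
  also have "\<dots> \<le> (1 + 2 * \<bar>mean\<bar>) * (\<delta> * (2 / a)) + \<delta> * (2 / b)"
    by (intro add_mono mult_left_mono d1 T) simp
  also have "\<dots> = \<delta> * ((1 + 2 * \<bar>mean\<bar>) * (2 / a) + 2 / b)"
    by (simp only: distrib_left mult.left_commute)
  finally show ?thesis
    unfolding m_def a_def b_def .
qed

lemma tilted_concentration:
  assumes "open U" "(mean, mean\<^sup>2 + var) \<in> U"
  obtains R \<eta> n0 where "R > 0" "\<eta> > 0"
    "\<And>n. n \<ge> n0 \<Longrightarrow> \<eta> \<le> measure (Q n) {z. \<bar>fst z - mean\<bar> \<le> R \<and> (1 / real (Suc n)) *\<^sub>R snd z \<in> U}"
proof -
  obtain r where r: "r > 0" "ball (mean, mean\<^sup>2 + var) r \<subseteq> U"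
    using assms by (meson open_contains_ball)
  define K where "K = (1 + 2 * \<bar>mean\<bar>) * (2 / (1 - \<theta> * w)) + 2 / (1 - (\<theta> * w)\<^sup>2)"
  have K: "K > 0"
  proof -
    have "0 < 1 + 2 * \<bar>mean\<bar>" by linarith
    then show ?thesis
      unfolding K_def using abs_phi_less_1 phi_sq_less_1
      by (intro add_pos_pos[of "_ * _"] mult_pos_pos divide_pos_pos) auto
  qed
  define \<delta> where "\<delta> = r / (2 * K)"
  have \<delta>: "\<delta> > 0" "\<delta> * K < r"
    using r K by (simp_all add: \<delta>_def)
  obtain R \<eta> n0 where R: "R > 0" "\<eta> > 0" and n0:
    "\<And>n. n \<ge> n0 \<Longrightarrow> \<eta> \<le> measure (Q n) {z. \<bar>fst z - mean\<bar> \<le> R \<and>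
       \<bar>linear_mart n z\<bar> \<le> \<delta> * real (Suc n) \<and> \<bar>square_mart n z\<bar> \<le> \<delta> * real (Suc n)}"
    using weak_law_event[OF \<delta>(1)] by blast
  define n1 where "n1 = nat \<lceil>(R + R\<^sup>2 + var) / \<delta>\<rceil>"
  show ?thesis
  proof (rule that[of R \<eta> "max n0 n1"])
    fix n assume n: "max n0 n1 \<le> n"
    interpret finite_measure "Q n" by (rule finite_measure_Q)
    have "(R + R\<^sup>2 + var) / \<delta> \<le> real n1"
      unfolding n1_def by (rule real_nat_ceiling_ge)
    also have "real n1 \<le> real (Suc n)"
      using n by simp
    finally have big: "R + R\<^sup>2 + var \<le> \<delta> * real (Suc n)"
      using \<delta> by (simp add: pos_divide_le_eq mult.commute)
    have sub: "{z. \<bar>fst z - mean\<bar> \<le> R \<and>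
       \<bar>linear_mart n z\<bar> \<le> \<delta> * real (Suc n) \<and> \<bar>square_mart n z\<bar> \<le> \<delta> * real (Suc n)} \<subseteq>
       {z. \<bar>fst z - mean\<bar> \<le> R \<and> (1 / real (Suc n)) *\<^sub>R snd z \<in> U}"
    proof
      fix z
      assume "z \<in> {z. \<bar>fst z - mean\<bar> \<le> R \<and>
       \<bar>linear_mart n z\<bar> \<le> \<delta> * real (Suc n) \<and> \<bar>square_mart n z\<bar> \<le> \<delta> * real (Suc n)}"
      moreover obtain x s t where z_eq: "z = (x, s, t)"
        by (cases z) auto
      ultimately have z: "\<bar>x - mean\<bar> \<le> R" "\<bar>linear_mart n (x, s, t)\<bar> \<le> \<delta> * real (Suc n)"
        "\<bar>square_mart n (x, s, t)\<bar> \<le> \<delta> * real (Suc n)"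
        by (simp_all del: of_nat_Suc)
      have "dist ((1 / real (Suc n)) *\<^sub>R (s, t)) (mean, mean\<^sup>2 + var) \<le> \<delta> * K"
        unfolding K_def by (rule empirical_deviation[OF \<delta>(1) R(1) big z])
      then have "(1 / real (Suc n)) *\<^sub>R (s, t) \<in> ball (mean, mean\<^sup>2 + var) r"
        using \<delta>(2) by (simp only: mem_ball dist_commute[of "(mean, mean\<^sup>2 + var)"])
      then have "(1 / real (Suc n)) *\<^sub>R (s, t) \<in> U"
        using r(2) by blast
      with z(1) show "z \<in> {z. \<bar>fst z - mean\<bar> \<le> R \<and> (1 / real (Suc n)) *\<^sub>R snd z \<in> U}"
        by (simp add: z_eq del: of_nat_Suc scaleR_Pair)
    qed
    have [measurable]: "U \<in> sets borel" using assms by simp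
    have "\<eta> \<le> measure (Q n) {z. \<bar>fst z - mean\<bar> \<le> R \<and>
       \<bar>linear_mart n z\<bar> \<le> \<delta> * real (Suc n) \<and> \<bar>square_mart n z\<bar> \<le> \<delta> * real (Suc n)}"
      using n by (intro n0) simp
    also have "\<dots> \<le> measure (Q n) {z. \<bar>fst z - mean\<bar> \<le> R \<and> (1 / real (Suc n)) *\<^sub>R snd z \<in> U}"
      by (rule finite_measure_mono[OF sub]) measurable
    finally show "\<eta> \<le> measure (Q n) {z. \<bar>fst z - mean\<bar> \<le> R \<and> (1 / real (Suc n)) *\<^sub>R snd z \<in> U}" .
  qed (use R in auto)
qed

section \<open>Exponential bounds for the given chain\<close>

lemma prob_space_P: "prob_space (P n)"
proof -
  have "prob_space (ar_stationary \<theta>)"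
    unfolding ar_stationary_def using theta_square_less_1 by (intro prob_space_normal_density) simp
  then have "emeasure (ar_stationary \<theta>) UNIV = 1"
    using prob_space.emeasure_space_1 sets_eq_imp_space_eq[OF sets_ar_stationary] by fastforce
  then show ?thesis
    by (intro prob_spaceI) (simp add: emeasure_chain)
qed

lemma exponent_rescale:
  "lam * fst (snd z) + mu * snd (snd z) = real (Suc n) * (tilt_affine \<theta> w c ((1 / real (Suc n)) *\<^sub>R snd z) + Lam)"
  by (simp add: tilt_affine_def case_prod_beta field_simps del: of_nat_Suc)

lemma half_space_upper_bound:
  obtains C where "0 < C" "\<And>n \<alpha>. measure (P n) {z. \<alpha> < tilt_affine \<theta> w c ((1 / real (Suc n)) *\<^sub>R snd z)}
     \<le> C * exp (- (real (Suc n) * \<alpha>))"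
proof -
  obtain C where C: "0 < C"
    "\<And>n. (\<integral>\<^sup>+z. ennreal (exp (lam * fst (snd z) + mu * snd (snd z))) \<partial>P n) \<le> ennreal (C * exp (real n * Lam))"
    by (rule exponential_moment_bound) blast
  have "measure (P n) {z. \<alpha> < tilt_affine \<theta> w c ((1 / real (Suc n)) *\<^sub>R snd z)} \<le>
      C * exp (- Lam) * exp (- (real (Suc n) * \<alpha>))" for n \<alpha>
  proof -
    interpret prob_space "P n" by (rule prob_space_P)
    let ?m = "real (Suc n)" and ?f = "\<lambda>z. exp (lam * fst (snd z) + mu * snd (snd z))"
    let ?k = "exp (- (?m * (\<alpha> + Lam)))"
    have "{z. \<alpha> < tilt_affine \<theta> w c ((1 / ?m) *\<^sub>R snd z)} \<subseteq> {z \<in> UNIV. 1 \<le> ennreal ?k * ennreal (?f z)}"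
    proof clarify
      fix z assume "\<alpha> < tilt_affine \<theta> w c ((1 / ?m) *\<^sub>R snd z)"
      then have "?m * (\<alpha> + Lam) \<le> lam * fst (snd z) + mu * snd (snd z)"
        unfolding exponent_rescale[of z n] by (intro mult_left_mono) auto
      then have "1 \<le> ?k * ?f z"
        by (simp add: exp_add[symmetric] del: of_nat_Suc)
      then show "z \<in> UNIV \<and> 1 \<le> ennreal ?k * ennreal (?f z)"
        by (simp add: ennreal_mult[symmetric] del: ennreal_1 of_nat_Suc flip: ennreal_1)
    qed
    then have "emeasure (P n) {z. \<alpha> < tilt_affine \<theta> w c ((1 / ?m) *\<^sub>R snd z)} \<le>
       emeasure (P n) {z \<in> UNIV. 1 \<le> ennreal ?k * ennreal (?f z)}"
      by (intro emeasure_mono) measurable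
    also have "\<dots> \<le> ennreal ?k * (\<integral>\<^sup>+z. ennreal (?f z) * indicator UNIV z \<partial>P n)"
      by (rule nn_integral_Markov_inequality) measurable
    also have "\<dots> \<le> ennreal ?k * ennreal (C * exp (real n * Lam))"
      using C(2)[of n] by (intro mult_left_mono) auto
    also have "\<dots> = ennreal (C * exp (- Lam) * exp (- (?m * \<alpha>)))"
      using C(1) by (simp add: ennreal_mult[symmetric] exp_add[symmetric] exp_minus[symmetric] mult_ac algebra_simps)
    finally show ?thesis
      using C(1) by (simp add: emeasure_eq_measure)
  qed
  then show ?thesis
    using that[of "C * exp (- Lam)"] C(1) by simp
qed

text \<open>After the set is intersected with the half-plane where the affine exponent exceeds its value at the
  centre by less than \<open>\<epsilon>\<close>, the density of the change of measure has the required exponential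
  lower bound on the event of \<open>tilted_concentration\<close>.\<close>

lemma open_set_lower_bound:
  assumes "open U" "(mean, mean\<^sup>2 + var) \<in> U" "\<epsilon> > 0"
  obtains K n0 where "K > 0"
    "\<And>n. n \<ge> n0 \<Longrightarrow> K * exp (- (real (Suc n) * (tilt_affine \<theta> w c (mean, mean\<^sup>2 + var) + \<epsilon>))) \<le>
       measure (P n) {z. (1 / real (Suc n)) *\<^sub>R snd z \<in> U}"
proof -
  let ?p = "(mean, mean\<^sup>2 + var)"
  define a where "a = tilt_affine \<theta> w c ?p + \<epsilon>"
  define U' where "U' = U \<inter> {q. tilt_affine \<theta> w c q < a}"
  have "open U'"
    unfolding U'_def by (intro open_Int assms open_Collect_less continuous_intros)
  moreover have "?p \<in> U'"
    using assms by (simp add: U'_def a_def)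
  ultimately obtain R \<eta> n0 where R: "R > 0" "\<eta> > 0" and n0:
    "\<And>n. n \<ge> n0 \<Longrightarrow> \<eta> \<le> measure (Q n) {z. \<bar>fst z - mean\<bar> \<le> R \<and> (1 / real (Suc n)) *\<^sub>R snd z \<in> U'}"
    using tilted_concentration by blast
  define H where "H = exp (\<bar>\<theta>\<^sup>2 * (w - 1) / 2\<bar> * (\<bar>mean\<bar> + R)\<^sup>2 + \<bar>\<theta> * c\<bar> * (\<bar>mean\<bar> + R))"
  have h: "h x \<le> H" if "\<bar>x - mean\<bar> \<le> R" for x
  proof -
    have x: "\<bar>x\<bar> \<le> \<bar>mean\<bar> + R" using that by linarith
    then have "x\<^sup>2 \<le> (\<bar>mean\<bar> + R)\<^sup>2"
      using R by (simp add: abs_le_square_iff[symmetric])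
    then have "\<theta>\<^sup>2 * (w - 1) / 2 * x\<^sup>2 \<le> \<bar>\<theta>\<^sup>2 * (w - 1) / 2\<bar> * (\<bar>mean\<bar> + R)\<^sup>2"
      by (intro mult_mono) auto
    moreover have "\<theta> * c * x \<le> \<bar>\<theta> * c\<bar> * (\<bar>mean\<bar> + R)"
    proof -
      have "\<theta> * c * x \<le> \<bar>\<theta> * c\<bar> * \<bar>x\<bar>"
        unfolding abs_mult[symmetric] by (rule abs_ge_self)
      also have "\<dots> \<le> \<bar>\<theta> * c\<bar> * (\<bar>mean\<bar> + R)"
        by (intro mult_left_mono x) simp
      finally show ?thesis .
    qed
    ultimately show ?thesis
      by (simp add: tilt_h_def H_def)
  qed
  have H: "H > 0" by (simp add: H_def)
  show ?thesis
  proof (rule that[of "\<eta> * exp (- Lam) / H" n0])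
    show "0 < \<eta> * exp (- Lam) / H" using R H by simp
    fix n assume n: "n0 \<le> n"
    interpret P: prob_space "P n" by (rule prob_space_P)
    interpret Q: finite_measure "Q n" by (rule finite_measure_Q)
    let ?m = "real (Suc n)"
    have [measurable]: "U \<in> sets borel" "U' \<in> sets borel"
      using assms(1) \<open>open U'\<close> by auto
    define A where "A = {z. \<bar>fst z - mean\<bar> \<le> R \<and> (1 / ?m) *\<^sub>R snd z \<in> U'}"
    have A [measurable]: "A \<in> sets borel"
      unfolding A_def by measurable
    have k: "exp (- (?m * (a + Lam))) / H \<le> 1 / W z" if "z \<in> A" for z
    proof -
      have "tilt_affine \<theta> w c ((1 / ?m) *\<^sub>R snd z) < a"
        using that by (simp add: A_def U'_def)
      then have "lam * fst (snd z) + mu * snd (snd z) \<le> ?m * (a + Lam)"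
        unfolding exponent_rescale[of z n] by (intro mult_left_mono) auto
      then have "W z \<le> exp (?m * (a + Lam)) * H"
        unfolding weight_eq using that h[of "fst z"] by (intro mult_mono) (auto simp: A_def less_imp_le)
      then have "1 / (exp (?m * (a + Lam)) * H) \<le> 1 / W z"
        by (intro divide_left_mono) (auto simp: H)
      then show ?thesis
        by (simp only: exp_minus) (simp add: field_simps del: of_nat_Suc)
    qed
    have "ennreal (exp (real n * Lam) * (exp (- (?m * (a + Lam))) / H) * \<eta>) \<le>
       ennreal (exp (real n * Lam)) * (ennreal (exp (- (?m * (a + Lam))) / H) * emeasure (Q n) A)"
    proof -
      have "\<eta> \<le> measure (Q n) A"
        using n0[OF n] by (simp add: A_def)
      then have "exp (real n * Lam) * (exp (- (?m * (a + Lam))) / H) * \<eta> \<le>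
          exp (real n * Lam) * (exp (- (?m * (a + Lam))) / H) * measure (Q n) A"
        using H by (intro mult_left_mono) auto
      then show ?thesis
        using H by (simp add: Q.emeasure_eq_measure ennreal_mult[symmetric] mult.assoc ennreal_leI del: of_nat_Suc)
    qed
    also have "ennreal (exp (- (?m * (a + Lam))) / H) * emeasure (Q n) A =
       (\<integral>\<^sup>+z. ennreal (exp (- (?m * (a + Lam))) / H) * indicator A z \<partial>Q n)"
      by (subst nn_integral_cmult_indicator) auto
    also have "\<dots> \<le> (\<integral>\<^sup>+z. ennreal (1 / W z) * indicator A z \<partial>Q n)"
      by (intro nn_integral_mono) (auto split: split_indicator intro!: ennreal_leI k simp del: of_nat_Suc)
    also have "ennreal (exp (real n * Lam)) * \<dots> = (\<integral>\<^sup>+z. ennreal (1 / W z) * indicator A z * ennreal (W z) \<partial>P n)"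
      by (subst change_of_measure) auto
    also have "\<dots> = (\<integral>\<^sup>+z. indicator A z \<partial>P n)"
    proof (rule nn_integral_cong)
      fix z
      have "ennreal (1 / W z) * ennreal (W z) = 1"
        using tilt_weight_pos[of \<theta> w c z] by (simp add: ennreal_mult[symmetric] del: tilt_weight_pos)
      then show "ennreal (1 / W z) * indicator A z * ennreal (W z) = indicator A z"
        by (simp split: split_indicator)
    qed
    also have "\<dots> = emeasure (P n) A"
      by simp
    finally have "ennreal (exp (real n * Lam) * (exp (- (?m * (a + Lam))) / H) * \<eta>) \<le> emeasure (P n) A"
      by (simp add: mult_left_mono)
    then have "exp (real n * Lam) * (exp (- (?m * (a + Lam))) / H) * \<eta> \<le> measure (P n) A"
      by (simp add: P.emeasure_eq_measure del: of_nat_Suc)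
    also have "\<dots> \<le> measure (P n) {z. (1 / ?m) *\<^sub>R snd z \<in> U}"
      by (intro P.finite_measure_mono) (auto simp: A_def U'_def)
    finally have "exp (real n * Lam) * exp (- (?m * (a + Lam))) * (\<eta> / H) \<le> measure (P n) {z. (1 / ?m) *\<^sub>R snd z \<in> U}"
      by simp
    moreover have "exp (real n * Lam) * exp (- (?m * (a + Lam))) = exp (- Lam) * exp (- (?m * a))"
      by (simp add: exp_add[symmetric] algebra_simps)
    ultimately show "\<eta> * exp (- Lam) / H * exp (- (?m * (tilt_affine \<theta> w c ?p + \<epsilon>))) \<le>
        measure (P n) {z. (1 / ?m) *\<^sub>R snd z \<in> U}"
      by (simp add: a_def mult_ac)
  qed
qed

end

section \<open>The law of the process\<close>

primrec path_state :: "real \<Rightarrow> (nat \<Rightarrow> real) \<Rightarrow> nat \<Rightarrow> real \<times> real \<times> real" where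
  "path_state \<theta> v 0 = (v 1, v 1, (v 1)\<^sup>2)"
| "path_state \<theta> v (Suc n) = chain_step (\<theta> * fst (path_state \<theta> v n) + 0 + 1 * v (n + 2)) (path_state \<theta> v n)"

lemma path_state_restrict: "path_state \<theta> (restrict v {1..Suc n}) n = path_state \<theta> v n"
proof -
  have "path_state \<theta> (restrict v {1..Suc N}) n = path_state \<theta> v n" if "n \<le> N" for n N
    using that by (induction n) auto
  then show ?thesis by simp
qed

lemma path_state_measurable:
  "(\<lambda>v. path_state \<theta> v n) \<in> borel_measurable (PiM {1..Suc n} (\<lambda>_. borel))"
proof -
  have "(\<lambda>v. path_state \<theta> v n) \<in> borel_measurable (PiM {1..Suc N} (\<lambda>_. borel))" if "n \<le> N" for n N
    using that
  proof (induction n)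
    case 0
    have [measurable]: "(\<lambda>v. v 1) \<in> borel_measurable (PiM {1..Suc N} (\<lambda>_. borel :: real measure))"
      by (rule measurable_component_singleton) simp
    show ?case by simp
  next
    case (Suc n)
    then have [measurable]: "(\<lambda>v. path_state \<theta> v n) \<in> borel_measurable (PiM {1..Suc N} (\<lambda>_. borel))"
      by simp
    have [measurable]: "(\<lambda>v. v (n + 2)) \<in> borel_measurable (PiM {1..Suc N} (\<lambda>_. borel :: real measure))"
      using Suc.prems by (intro measurable_component_singleton) simp
    show ?case
      unfolding path_state.simps by measurable
  qed
  then show ?thesis by simp
qed

context stationary_AR1
begin

definition noise :: "nat \<Rightarrow> 'w \<Rightarrow> real" where
  "noise k = (if k = 1 then X 1 else \<epsilon> k)"

lemma noise_measurable: "1 \<le> k \<Longrightarrow> noise k \<in> borel_measurable M"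
  using distributed_measurable[OF initial_distr] distributed_measurable[OF innovations_distr, of k]
  by (auto simp: noise_def measurable_lborel2)

text \<open>Joins the independence of the innovations with the independence of \<open>X 1\<close> from all of them.\<close>

lemma noise_indep: "indep_vars (\<lambda>_. borel) noise {1..}"
  unfolding indep_vars_def2
proof (intro conjI ballI)
  fix k :: nat assume "k \<in> {1..}"
  then show "random_variable borel (noise k)"
    by (simp add: noise_measurable)
next
  let ?F = "\<lambda>i. {noise i -` A \<inter> space M |A. A \<in> sets borel}"
  have eps: "indep_sets (\<lambda>i. {\<epsilon> i -` A \<inter> space M |A. A \<in> sets borel}) {2..}"
    using innovations_indep by (simp add: indep_vars_def2)
  show "indep_sets ?F {1..}"
  proof (rule indep_setsI)
    show "?F i \<subseteq> events" if "i \<in> {1..}" for i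
      using noise_measurable[of i] that by (auto simp: measurable_sets)
  next
    fix A J assume J: "J \<noteq> {}" "J \<subseteq> {1::nat..}" "finite J" and A: "\<forall>j\<in>J. A j \<in> ?F j"
    define J' where "J' = J - {1}"
    have J': "J' \<subseteq> {2..}" "finite J'" "1 \<notin> J'"
      using J by (auto simp: J'_def Suc_le_eq)
    have AJ': "A j \<in> {\<epsilon> j -` A \<inter> space M |A. A \<in> sets borel}" if "j \<in> J'" for j
    proof -
      have "A j \<in> ?F j" "j \<noteq> 1"
        using A that by (auto simp only: J'_def)
      then show ?thesis
        by (simp add: noise_def)
    qed
    have prodJ': "prob (\<Inter>j\<in>J'. A j) = (\<Prod>j\<in>J'. prob (A j))" if "J' \<noteq> {}"
      using indep_setsD[OF eps J'(1) that J'(2)] AJ' by auto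
    show "prob (\<Inter>j\<in>J. A j) = (\<Prod>j\<in>J. prob (A j))"
    proof (cases "1 \<in> J")
      case False
      then have "J = J'" by (auto simp: J'_def)
      then show ?thesis using prodJ' J by simp
    next
      case True
      then have J_eq: "J = insert 1 J'" by (auto simp: J'_def)
      show ?thesis
      proof (cases "J' = {}")
        case True
        then show ?thesis by (simp add: J_eq)
      next
        case False
        have "A 1 \<in> ?F 1"
          using A True by blast
        then have A1: "A 1 \<in> sets (vimage_algebra (space M) (X 1) borel)"
          by (auto simp: noise_def intro!: in_vimage_algebra)
        let ?V = "vimage_algebra (space M) (\<lambda>\<omega>. \<lambda>n\<in>{2..}. \<epsilon> n \<omega>) (\<Pi>\<^sub>M n\<in>{2::nat..}. (borel :: real measure))"
        have "A j \<in> sets ?V" if j: "j \<in> J'" for j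
        proof -
          obtain B where B: "A j = \<epsilon> j -` B \<inter> space M" "B \<in> sets borel"
            using AJ'[OF j] by auto
          have j2: "j \<in> {2..}" using j J' by auto
          have "(\<lambda>v. v j) -` B \<inter> space (\<Pi>\<^sub>M n\<in>{2::nat..}. (borel :: real measure)) \<in> sets (\<Pi>\<^sub>M n\<in>{2::nat..}. (borel :: real measure))"
            using measurable_sets[OF measurable_component_singleton[OF j2] B(2)] .
          then have "(\<lambda>\<omega>. \<lambda>n\<in>{2..}. \<epsilon> n \<omega>) -` ((\<lambda>v. v j) -` B \<inter> space (\<Pi>\<^sub>M n\<in>{2::nat..}. (borel :: real measure))) \<inter> space M \<in> sets ?V"
            by (rule in_vimage_algebra)
          moreover have "(\<lambda>\<omega>. \<lambda>n\<in>{2..}. \<epsilon> n \<omega>) -` ((\<lambda>v. v j) -` B \<inter> space (\<Pi>\<^sub>M n\<in>{2::nat..}. (borel :: real measure))) \<inter> space M = A j"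
            using j2 by (auto simp: B(1) space_PiM)
          ultimately show ?thesis by simp
        qed
        then have "(\<Inter>j\<in>J'. A j) \<in> sets ?V"
          using J'(2) False by (intro sets.finite_INT) auto
        then have "prob (A 1 \<inter> (\<Inter>j\<in>J'. A j)) = prob (A 1) * prob (\<Inter>j\<in>J'. A j)"
          using indep_setD[OF initial_indep A1] by simp
        then show ?thesis
          using prodJ'[OF False] J' by (simp add: J_eq)
      qed
    qed
  qed
qed

lemma path_measurable: "(\<lambda>\<omega>. path_state \<theta> (\<lambda>k. noise k \<omega>) n) \<in> borel_measurable M"
proof -
  have "(\<lambda>\<omega>. restrict (\<lambda>k. noise k \<omega>) {1..Suc n}) \<in> measurable M (PiM {1..Suc n} (\<lambda>_. borel))"
    by (intro measurable_restrict noise_measurable) simp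
  from measurable_compose[OF this path_state_measurable] show ?thesis
    by (simp only: path_state_restrict)
qed

text \<open>The two variables take values in different types, so their independence is expressed by the
  product law, which is pushed forward from the independent restrictions of the noise to disjoint
  index sets.\<close>

lemma distr_path_noise:
  "distr M borel (\<lambda>\<omega>. path_state \<theta> (\<lambda>k. noise k \<omega>) n) \<Otimes>\<^sub>M distr M borel (noise (n + 2)) =
     distr M (borel \<Otimes>\<^sub>M borel) (\<lambda>\<omega>. (path_state \<theta> (\<lambda>k. noise k \<omega>) n, noise (n + 2) \<omega>))"
proof -
  let ?A = "{1..Suc n}" and ?B = "{n + 2}"
  let ?PA = "PiM ?A (\<lambda>_. borel :: real measure)" and ?PB = "PiM ?B (\<lambda>_. borel :: real measure)"
  let ?u = "\<lambda>\<omega>. restrict (\<lambda>k. noise k \<omega>) ?A" and ?v = "\<lambda>\<omega>. restrict (\<lambda>k. noise k \<omega>) ?B"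
  let ?f = "\<lambda>v. path_state \<theta> v n" and ?g = "\<lambda>v :: nat \<Rightarrow> real. v (n + 2)"
  have "indep_var ?PA ?u ?PB ?v"
    by (rule indep_var_restrict[OF noise_indep]) auto
  then have u: "?u \<in> measurable M ?PA" and v: "?v \<in> measurable M ?PB"
    and uv: "distr M ?PA ?u \<Otimes>\<^sub>M distr M ?PB ?v = distr M (?PA \<Otimes>\<^sub>M ?PB) (\<lambda>\<omega>. (?u \<omega>, ?v \<omega>))"
    unfolding indep_var_distribution_eq by blast+
  have f: "?f \<in> borel_measurable ?PA"
    by (rule path_state_measurable)
  have g: "?g \<in> borel_measurable ?PB"
    by (rule measurable_component_singleton) simp
  have fu: "distr M borel (\<lambda>\<omega>. path_state \<theta> (\<lambda>k. noise k \<omega>) n) = distr (distr M ?PA ?u) borel ?f"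
    by (subst distr_distr[OF f u]) (simp add: comp_def path_state_restrict del: One_nat_def)
  have gv: "distr M borel (noise (n + 2)) = distr (distr M ?PB ?v) borel ?g"
    by (subst distr_distr[OF g v]) (simp add: comp_def)
  have "prob_space (distr M borel (noise (n + 2)))"
    by (intro prob_space_distr noise_measurable) simp
  then have sf: "sigma_finite_measure (distr (distr M ?PB ?v) borel ?g)"
    unfolding gv by (rule prob_space_imp_sigma_finite)
  have "distr (distr M ?PA ?u) borel ?f \<Otimes>\<^sub>M distr (distr M ?PB ?v) borel ?g =
     distr (distr M ?PA ?u \<Otimes>\<^sub>M distr M ?PB ?v) (borel \<Otimes>\<^sub>M borel) (\<lambda>(a, b). (?f a, ?g b))"
    by (rule pair_measure_distr[OF _ _ sf]) (use f g in simp_all)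
  also have "\<dots> = distr M (borel \<Otimes>\<^sub>M borel) ((\<lambda>(a, b). (?f a, ?g b)) \<circ> (\<lambda>\<omega>. (?u \<omega>, ?v \<omega>)))"
    unfolding uv
  proof (rule distr_distr)
    note [measurable] = f g u v
    show "(\<lambda>(a, b). (?f a, ?g b)) \<in> measurable (?PA \<Otimes>\<^sub>M ?PB) (borel \<Otimes>\<^sub>M borel)"
      by measurable
    show "(\<lambda>\<omega>. (?u \<omega>, ?v \<omega>)) \<in> measurable M (?PA \<Otimes>\<^sub>M ?PB)"
      by measurable
  qed
  finally show ?thesis
    unfolding fu[symmetric] gv[symmetric] by (simp add: comp_def path_state_restrict del: One_nat_def)
qed

lemma distr_X1: "distr M borel (X 1) = ar_stationary \<theta>"
  using distributed_distr_eq_density[OF initial_distr]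
  by (simp add: ar_stationary_def distr_cong[of M M lborel borel])

lemma distr_innovation: "distr M borel (noise (n + 2)) = density lborel std_normal_density"
  using distributed_distr_eq_density[OF innovations_distr[of "n + 2"]]
  by (simp add: noise_def distr_cong[of M M lborel borel])

lemma distr_path_state:
  "distr M borel (\<lambda>\<omega>. path_state \<theta> (\<lambda>k. noise k \<omega>) n) = ar_chain \<theta> 0 1 (ar_stationary \<theta>) n"
proof (induction n)
  case 0
  have X1: "X 1 \<in> borel_measurable M"
    using noise_measurable[OF order_refl] by (simp only: noise_def simp_thms if_True)
  have "distr M borel (\<lambda>\<omega>. path_state \<theta> (\<lambda>k. noise k \<omega>) 0) = distr (distr M borel (X 1)) borel (\<lambda>x. (x, x, x\<^sup>2))"
    by (subst distr_distr) (use X1 in \<open>auto simp: comp_def noise_def\<close>)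
  then show ?case
    by (simp only: distr_X1 ar_chain.simps)
next
  case (Suc n)
  let ?Z = "\<lambda>\<omega>. path_state \<theta> (\<lambda>k. noise k \<omega>) n"
  have [measurable]: "?Z \<in> borel_measurable M" "noise (Suc (Suc n)) \<in> borel_measurable M"
    by (rule path_measurable, rule noise_measurable) simp
  have "ar_chain \<theta> 0 1 (ar_stationary \<theta>) (Suc n) =
     distr (distr M borel ?Z \<Otimes>\<^sub>M distr M borel (noise (n + 2))) borel
       (\<lambda>(z, e). chain_step (\<theta> * fst z + 0 + 1 * e) z)"
    by (simp only: ar_chain.simps Suc distr_innovation)
  also have "\<dots> = distr (distr M (borel \<Otimes>\<^sub>M borel) (\<lambda>\<omega>. (?Z \<omega>, noise (n + 2) \<omega>))) borel
       (\<lambda>(z, e). chain_step (\<theta> * fst z + 0 + 1 * e) z)"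
    by (simp only: distr_path_noise)
  also have "\<dots> = distr M borel (\<lambda>\<omega>. path_state \<theta> (\<lambda>k. noise k \<omega>) (Suc n))"
    by (subst distr_distr) (auto simp: comp_def case_prod_beta)
  finally show ?case ..
qed

lemma path_state_eq:
  assumes "\<omega> \<in> space M"
  shows "path_state \<theta> (\<lambda>k. noise k \<omega>) n = (X (Suc n) \<omega>, \<Sum>k=1..Suc n. X k \<omega>, \<Sum>k=1..Suc n. (X k \<omega>)\<^sup>2)"
proof (induction n)
  case 0
  show ?case by (simp add: noise_def)
next
  case (Suc n)
  have "X (Suc (Suc n)) \<omega> = \<theta> * X (Suc n) \<omega> + \<epsilon> (Suc (Suc n)) \<omega>"
    using recursion[of "Suc n" \<omega>] assms by simp
  then show ?case
    unfolding path_state.simps Suc by (simp add: chain_step_def noise_def)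
qed

lemma distr_sums:
  "distr M borel (\<lambda>\<omega>. (X (Suc n) \<omega>, \<Sum>k=1..Suc n. X k \<omega>, \<Sum>k=1..Suc n. (X k \<omega>)\<^sup>2)) =
     ar_chain \<theta> 0 1 (ar_stationary \<theta>) n"
  unfolding distr_path_state[symmetric] by (intro distr_cong refl) (simp only: path_state_eq)

lemma sums_measurable:
  "(\<lambda>\<omega>. (X (Suc n) \<omega>, \<Sum>k=1..Suc n. X k \<omega>, \<Sum>k=1..Suc n. (X k \<omega>)\<^sup>2)) \<in> borel_measurable M"
  using path_measurable by (subst measurable_cong[OF path_state_eq[symmetric]])

end

section \<open>The large deviation principle\<close>

lemma limsup_log_prob_le:
  fixes p :: "nat \<Rightarrow> real"
  assumes "0 < C" and p: "\<And>n. n \<ge> 1 \<Longrightarrow> 0 \<le> p n" "\<And>n. n \<ge> 1 \<Longrightarrow> p n \<le> C * exp (- (real n * \<alpha>))"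
  shows "limsup (\<lambda>n. ereal (1 / real n) * log_prob (p n)) \<le> ereal (- \<alpha>)"
proof -
  have "limsup (\<lambda>n. ereal (1 / real n) * log_prob (p n)) \<le> limsup (\<lambda>n. ereal (ln C / real n - \<alpha>))"
  proof (rule Limsup_mono, rule eventually_sequentiallyI)
    fix n :: nat assume n: "1 \<le> n"
    show "ereal (1 / real n) * log_prob (p n) \<le> ereal (ln C / real n - \<alpha>)"
    proof (cases "p n = 0")
      case True
      then show ?thesis using n by (simp add: log_prob_def)
    next
      case False
      then have pos: "0 < p n" using p(1)[OF n] by simp
      have "ln (p n) \<le> ln (C * exp (- (real n * \<alpha>)))"
        using p(2)[OF n] pos assms(1) by (subst ln_le_cancel_iff) auto
      also have "\<dots> = ln C - real n * \<alpha>"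
        using assms(1) by (simp add: ln_mult)
      finally have "ln (p n) / real n \<le> (ln C - real n * \<alpha>) / real n"
        by (intro divide_right_mono) auto
      then show ?thesis
        using n pos by (simp add: log_prob_def diff_divide_distrib)
    qed
  qed
  also have "(\<lambda>n. ln C / real n - \<alpha>) \<longlonglongrightarrow> 0 - \<alpha>"
    by (intro tendsto_diff lim_const_over_n tendsto_const)
  then have "limsup (\<lambda>n. ereal (ln C / real n - \<alpha>)) = ereal (- \<alpha>)"
    by (intro lim_imp_Limsup) auto
  finally show ?thesis .
qed

lemma liminf_log_prob_ge:
  fixes p :: "nat \<Rightarrow> real"
  assumes "0 < K" and p: "\<And>n. n \<ge> n0 \<Longrightarrow> K * exp (- (real n * \<alpha>)) \<le> p n"
  shows "ereal (- \<alpha>) \<le> liminf (\<lambda>n. ereal (1 / real n) * log_prob (p n))"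
proof -
  have "(\<lambda>n. ln K / real n - \<alpha>) \<longlonglongrightarrow> 0 - \<alpha>"
    by (intro tendsto_diff lim_const_over_n tendsto_const)
  then have "liminf (\<lambda>n. ereal (ln K / real n - \<alpha>)) = ereal (- \<alpha>)"
    by (intro lim_imp_Liminf) auto
  moreover have "liminf (\<lambda>n. ereal (ln K / real n - \<alpha>)) \<le> liminf (\<lambda>n. ereal (1 / real n) * log_prob (p n))"
  proof (rule Liminf_mono, rule eventually_sequentiallyI)
    fix n :: nat assume n: "max 1 n0 \<le> n"
    have "0 < K * exp (- (real n * \<alpha>))"
      using assms(1) by simp
    also have le: "\<dots> \<le> p n"
      using n by (intro p) simp
    finally have pos: "0 < p n" .
    have "ln K - real n * \<alpha> = ln (K * exp (- (real n * \<alpha>)))"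
      using assms(1) by (simp add: ln_mult)
    also have "\<dots> \<le> ln (p n)"
      using le pos assms(1) by (subst ln_le_cancel_iff) auto
    finally have "(ln K - real n * \<alpha>) / real n \<le> ln (p n) / real n"
      by (intro divide_right_mono) auto
    then show "ereal (ln K / real n - \<alpha>) \<le> ereal (1 / real n) * log_prob (p n)"
      using n pos by (simp add: log_prob_def diff_divide_distrib)
  qed
  ultimately show ?thesis
    by simp
qed

text \<open>A single half-plane bounded by a horizontal line takes care of all points with large \<open>y\<close>; the rest
  of the region \<open>x\<^sup>2 \<le> y\<close> is compact.\<close>

lemma closed_superlevel_cover:
  assumes "\<bar>\<theta>\<bar> < 1" "closed F" "\<And>q. q \<in> F \<Longrightarrow> ereal \<alpha> < J_S \<theta> q"
  obtains T where "finite T" "\<And>w c. (w, c) \<in> T \<Longrightarrow> tilt \<theta> w"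
    "\<And>q. q \<in> F \<Longrightarrow> (fst q)\<^sup>2 \<le> snd q \<Longrightarrow> \<exists>(w, c) \<in> T. \<alpha> < tilt_affine \<theta> w c q"
proof -
  obtain w0 where w0: "tilt \<theta> w0" "0 < tilt_mu \<theta> w0"
    using positive_mu_tilt[OF assms(1)] .
  define R where "R = (\<alpha> + tilt_Lam w0 0) / tilt_mu \<theta> w0"
  define K where "K = F \<inter> {q. (fst q)\<^sup>2 \<le> snd q \<and> snd q \<le> R}"
  have "compact K"
    unfolding K_def by (rule closed_Int_compact[OF assms(2) compact_parabola_cap])
  moreover have "open {q. \<alpha> < tilt_affine \<theta> (fst u) (snd u) q}" for u
    by (intro open_Collect_less continuous_intros)
  moreover have "K \<subseteq> (\<Union>u \<in> {u. tilt \<theta> (fst u)}. {q. \<alpha> < tilt_affine \<theta> (fst u) (snd u) q})"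
  proof
    fix q assume "q \<in> K"
    then have "ereal \<alpha> < J_S \<theta> q"
      using assms(3) by (simp add: K_def)
    then obtain w c where "tilt \<theta> w" "\<alpha> < tilt_affine \<theta> w c q"
      using less_J_S_imp_less_tilt_affine[OF assms(1)] by blast
    then show "q \<in> (\<Union>u \<in> {u. tilt \<theta> (fst u)}. {q. \<alpha> < tilt_affine \<theta> (fst u) (snd u) q})"
      by (intro UN_I[of "(w, c)"]) auto
  qed
  ultimately obtain T where T: "T \<subseteq> {u. tilt \<theta> (fst u)}" "finite T"
    "K \<subseteq> (\<Union>u\<in>T. {q. \<alpha> < tilt_affine \<theta> (fst u) (snd u) q})"
    by (rule compactE_image[where f = "\<lambda>u. {q. \<alpha> < tilt_affine \<theta> (fst u) (snd u) q}"]) blast+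
  show ?thesis
  proof (rule that[of "insert (w0, 0) T"])
    show "finite (insert (w0, 0) T)" using T by simp
    show "tilt \<theta> w" if "(w, c) \<in> insert (w0, 0) T" for w c
      using that T(1) w0(1) by auto
    fix q assume q: "q \<in> F" "(fst q)\<^sup>2 \<le> snd q"
    show "\<exists>(w, c) \<in> insert (w0, 0) T. \<alpha> < tilt_affine \<theta> w c q"
    proof (cases "snd q \<le> R")
      case True
      then have "q \<in> K"
        using q by (simp add: K_def)
      then obtain u where "u \<in> T" "\<alpha> < tilt_affine \<theta> (fst u) (snd u) q"
        using T(3) by blast
      then show ?thesis
        by (intro bexI[of _ u]) (auto simp: case_prod_beta)
    next
      case False
      then have "\<alpha> + tilt_Lam w0 0 < snd q * tilt_mu \<theta> w0"
        using w0(2) by (simp add: R_def pos_divide_less_eq not_le)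
      then have "\<alpha> < tilt_affine \<theta> w0 0 q"
        by (simp add: tilt_affine_def tilt_lam_def case_prod_beta mult.commute)
      then show ?thesis
        by auto
    qed
  qed
qed

context
  fixes M :: "'w measure" and \<theta> :: real and X \<epsilon> :: "nat \<Rightarrow> 'w \<Rightarrow> real"
    and S :: "nat \<Rightarrow> 'w \<Rightarrow> real \<times> real"
  assumes AR1: "stationary_AR1 M \<theta> X \<epsilon>"
    and S: "\<And>n \<omega>. n \<ge> 1 \<Longrightarrow> S n \<omega> = (1 / real n) *\<^sub>R (\<Sum>k=1..n. X k \<omega>, \<Sum>k=1..n. (X k \<omega>)\<^sup>2)"
begin

interpretation stationary_AR1 M \<theta> X \<epsilon>
  by (rule AR1)

lemma S_measurable: "n \<ge> 1 \<Longrightarrow> S n \<in> borel_measurable M"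
proof -
  assume "n \<ge> 1"
  then obtain k where n: "n = Suc k"
    by (cases n) auto
  have [measurable]: "(\<lambda>\<omega>. (X (Suc k) \<omega>, \<Sum>i=1..Suc k. X i \<omega>, \<Sum>i=1..Suc k. (X i \<omega>)\<^sup>2)) \<in> borel_measurable M"
    by (rule sums_measurable)
  have "(\<lambda>\<omega>. (1 / real (Suc k)) *\<^sub>R snd (X (Suc k) \<omega>, \<Sum>i=1..Suc k. X i \<omega>, \<Sum>i=1..Suc k. (X i \<omega>)\<^sup>2)) \<in> borel_measurable M"
    by measurable
  moreover have "S n = (\<lambda>\<omega>. (1 / real (Suc k)) *\<^sub>R snd (X (Suc k) \<omega>, \<Sum>i=1..Suc k. X i \<omega>, \<Sum>i=1..Suc k. (X i \<omega>)\<^sup>2))"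
    unfolding n snd_conv by (rule ext, rule S) simp
  ultimately show ?thesis
    by simp
qed

lemma prob_S_eq_chain:
  assumes "B \<in> sets borel"
  shows "prob {\<omega> \<in> space M. S (Suc n) \<omega> \<in> B} =
    measure (ar_chain \<theta> 0 1 (ar_stationary \<theta>) n) {z. (1 / real (Suc n)) *\<^sub>R snd z \<in> B}"
proof -
  have [measurable]: "B \<in> sets borel" by fact
  have "{z :: real \<times> real \<times> real. (1 / real (Suc n)) *\<^sub>R snd z \<in> B} \<in> sets borel"
    by measurable
  then have "measure (ar_chain \<theta> 0 1 (ar_stationary \<theta>) n) {z. (1 / real (Suc n)) *\<^sub>R snd z \<in> B} =
     prob ((\<lambda>\<omega>. (X (Suc n) \<omega>, \<Sum>k=1..Suc n. X k \<omega>, \<Sum>k=1..Suc n. (X k \<omega>)\<^sup>2)) -`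
        {z. (1 / real (Suc n)) *\<^sub>R snd z \<in> B} \<inter> space M)"
    unfolding distr_sums[symmetric] by (intro measure_distr sums_measurable)
  also have "(\<lambda>\<omega>. (X (Suc n) \<omega>, \<Sum>k=1..Suc n. X k \<omega>, \<Sum>k=1..Suc n. (X k \<omega>)\<^sup>2)) -`
        {z. (1 / real (Suc n)) *\<^sub>R snd z \<in> B} \<inter> space M = {\<omega> \<in> space M. S (Suc n) \<omega> \<in> B}"
  proof -
    have "S (Suc n) \<omega> = (1 / real (Suc n)) *\<^sub>R (\<Sum>k=1..Suc n. X k \<omega>, \<Sum>k=1..Suc n. (X k \<omega>)\<^sup>2)" for \<omega>
      by (rule S) simp
    then show ?thesis
      by (auto simp only: vimage_def mem_Collect_eq snd_conv Int_def)
  qed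
  finally show ?thesis ..
qed

lemma S_in_parabola:
  assumes "n \<ge> 1"
  shows "(fst (S n \<omega>))\<^sup>2 \<le> snd (S n \<omega>)"
proof -
  have "(\<Sum>k=1..n. X k \<omega>)\<^sup>2 \<le> (\<Sum>k=1..n. (X k \<omega>)\<^sup>2) * real n"
    using sum_squared_le_sum_of_squares[of "\<lambda>k. X k \<omega>" "{1..n}"] by simp
  then have "(\<Sum>k=1..n. X k \<omega>)\<^sup>2 / (real n)\<^sup>2 \<le> (\<Sum>k=1..n. (X k \<omega>)\<^sup>2) * real n / (real n)\<^sup>2"
    by (intro divide_right_mono) auto
  also have "\<dots> = (\<Sum>k=1..n. (X k \<omega>)\<^sup>2) / real n"
    using assms by (simp add: power2_eq_square)
  finally show ?thesis
    using assms by (simp add: S power_divide)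
qed

lemma LDP_upper_bound:
  assumes "closed F"
  shows "limsup (\<lambda>n. ereal (1 / real n) * log_prob (prob {\<omega> \<in> space M. S n \<omega> \<in> F})) \<le> - (INF q\<in>F. J_S \<theta> q)"
    (is "limsup ?l \<le> _")
proof -
  have "(INF q\<in>F. J_S \<theta> q) \<le> - limsup ?l"
  proof (rule dense_le)
    fix a assume a: "a < (INF q\<in>F. J_S \<theta> q)"
    show "a \<le> - limsup ?l"
    proof (cases a)
      case (real \<alpha>)
      have "ereal \<alpha> < J_S \<theta> q" if "q \<in> F" for q
        using a that unfolding real by (meson INF_lower less_le_trans)
      then obtain T where T: "finite T" "\<And>w c. (w, c) \<in> T \<Longrightarrow> tilt \<theta> w"
        "\<And>q. q \<in> F \<Longrightarrow> (fst q)\<^sup>2 \<le> snd q \<Longrightarrow> \<exists>(w, c) \<in> T. \<alpha> < tilt_affine \<theta> w c q"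
        using closed_superlevel_cover[OF abs_theta_less_1 assms, of \<alpha>] by blast
      let ?H = "\<lambda>u. {q. \<alpha> < tilt_affine \<theta> (fst u) (snd u) q}"
      have H: "?H u \<in> sets borel" for u
        by (intro borel_open open_Collect_less continuous_intros)
      have "\<exists>C. 0 < C \<and> (\<forall>n. measure (ar_chain \<theta> 0 1 (ar_stationary \<theta>) n)
          {z. \<alpha> < tilt_affine \<theta> (fst u) (snd u) ((1 / real (Suc n)) *\<^sub>R snd z)} \<le> C * exp (- (real (Suc n) * \<alpha>)))"
        if "u \<in> T" for u
        using tilt.half_space_upper_bound[OF T(2), of "fst u" "snd u" "snd u"] that by (metis prod.collapse)
      then obtain C where C: "\<And>u. u \<in> T \<Longrightarrow> 0 < C u"
        "\<And>u n. u \<in> T \<Longrightarrow> measure (ar_chain \<theta> 0 1 (ar_stationary \<theta>) n)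
          {z. \<alpha> < tilt_affine \<theta> (fst u) (snd u) ((1 / real (Suc n)) *\<^sub>R snd z)} \<le> C u * exp (- (real (Suc n) * \<alpha>))"
        by metis
      have "prob {\<omega> \<in> space M. S n \<omega> \<in> F} \<le> (1 + sum C T) * exp (- (real n * \<alpha>))" if n: "n \<ge> 1" for n
      proof -
        obtain k where k: "n = Suc k" using n by (cases n) auto
        have "{\<omega> \<in> space M. S n \<omega> \<in> F} \<subseteq> (\<Union>u\<in>T. {\<omega> \<in> space M. S n \<omega> \<in> ?H u})"
        proof
          fix \<omega> assume \<omega>: "\<omega> \<in> {\<omega> \<in> space M. S n \<omega> \<in> F}"
          then obtain u where "u \<in> T" "\<alpha> < tilt_affine \<theta> (fst u) (snd u) (S n \<omega>)"
            using T(3)[OF _ S_in_parabola[OF n]] by fastforce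
          then show "\<omega> \<in> (\<Union>u\<in>T. {\<omega> \<in> space M. S n \<omega> \<in> ?H u})"
            using \<omega> by blast
        qed
        moreover have ev: "{\<omega> \<in> space M. S n \<omega> \<in> ?H u} \<in> events" for u
          using measurable_sets[OF S_measurable[OF n] H[of u]] by (simp add: vimage_def Int_def conj_commute)
        ultimately have "prob {\<omega> \<in> space M. S n \<omega> \<in> F} \<le> prob (\<Union>u\<in>T. {\<omega> \<in> space M. S n \<omega> \<in> ?H u})"
          using T(1) by (intro finite_measure_mono sets.finite_UN) auto
        also have "\<dots> \<le> (\<Sum>u\<in>T. prob {\<omega> \<in> space M. S n \<omega> \<in> ?H u})"
          using T(1) ev by (intro finite_measure_subadditive_finite) auto
        also have "\<dots> \<le> (\<Sum>u\<in>T. C u * exp (- (real n * \<alpha>)))"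
          unfolding k prob_S_eq_chain[OF H] unfolding mem_Collect_eq by (intro sum_mono C(2))
        also have "\<dots> = sum C T * exp (- (real n * \<alpha>))"
          by (simp add: sum_distrib_right)
        also have "\<dots> \<le> (1 + sum C T) * exp (- (real n * \<alpha>))"
          by (intro mult_right_mono) auto
        finally show ?thesis .
      qed
      moreover have "0 < 1 + sum C T"
        using C(1) by (intro add_pos_nonneg sum_nonneg) (auto intro: less_imp_le)
      ultimately have "limsup ?l \<le> ereal (- \<alpha>)"
        by (intro limsup_log_prob_le) auto
      then show ?thesis
        unfolding real by (subst ereal_minus_le_minus[symmetric]) simp
    qed (use a in auto)
  qed
  then show ?thesis
    by (subst ereal_minus_le_minus[symmetric]) simp
qed

lemma LDP_lower_bound:
  assumes "open G"
  shows "- (INF q\<in>G. J_S \<theta> q) \<le> liminf (\<lambda>n. ereal (1 / real n) * log_prob (prob {\<omega> \<in> space M. S n \<omega> \<in> G}))"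
    (is "_ \<le> liminf ?l")
proof -
  have "- liminf ?l \<le> (INF q\<in>G. J_S \<theta> q)"
  proof (rule INF_greatest)
    fix q assume q: "q \<in> G"
    obtain x y where xy: "q = (x, y)" by (cases q) auto
    show "- liminf ?l \<le> J_S \<theta> q"
    proof (cases "y > x\<^sup>2")
      case False
      then show ?thesis by (simp add: xy J_S_infinity)
    next
      case True
      then obtain w where w: "tilt \<theta> w" "y = x\<^sup>2 + w / (1 - (\<theta> * w)\<^sup>2)"
        "J_S \<theta> (x, y) = ereal (tilt_affine \<theta> w ((1 - \<theta> * w) * x) (x, y))"
        using J_S_eq_tilt_affine[OF abs_theta_less_1] by blast
      interpret T: tilt \<theta> w "(1 - \<theta> * w) * x" by (rule w(1))
      have mv: "(T.mean, T.mean\<^sup>2 + T.var) = q"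
        using T.abs_phi_less_1 by (simp add: xy w(2) T.mean_def T.var_def)
      let ?a = "tilt_affine \<theta> w ((1 - \<theta> * w) * x) q"
      have "- ereal ?a \<le> liminf ?l + ereal e" if e: "e > 0" for e
      proof -
        obtain K n0 where K: "K > 0" "\<And>n. n \<ge> n0 \<Longrightarrow> K * exp (- (real (Suc n) * (?a + e))) \<le>
            measure (ar_chain \<theta> 0 1 (ar_stationary \<theta>) n) {z. (1 / real (Suc n)) *\<^sub>R snd z \<in> G}"
          using T.open_set_lower_bound[OF assms _ e] q unfolding mv by blast
        have "K * exp (- (real n * (?a + e))) \<le> prob {\<omega> \<in> space M. S n \<omega> \<in> G}" if n: "n \<ge> Suc n0" for n
        proof -
          obtain k where k: "n = Suc k" "k \<ge> n0" using n by (cases n) auto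
          show ?thesis
            using K(2)[OF k(2)] prob_S_eq_chain[OF borel_open[OF assms], of k] by (simp only: k(1))
        qed
        then have "ereal (- (?a + e)) \<le> liminf ?l"
          by (rule liminf_log_prob_ge[OF K(1)])
        then have "ereal (- (?a + e)) + ereal e \<le> liminf ?l + ereal e"
          by (rule add_right_mono)
        then show ?thesis
          by simp
      qed
      then have "- ereal ?a \<le> liminf ?l"
        by (rule ereal_le_epsilon2)
      then show ?thesis
        using w(3) by (simp add: xy ereal_uminus_le_reorder)
    qed
  qed
  then show ?thesis
    by (simp add: ereal_uminus_le_reorder)
qed

end

theorem mainTheorem2:
  fixes M :: "'w measure" and \<theta> :: real and X \<epsilon> :: "nat \<Rightarrow> 'w \<Rightarrow> real"
    and S :: "nat \<Rightarrow> 'w \<Rightarrow> real \<times> real"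
  assumes "\<theta> \<in> {-1<..<1}"
    and "stationary_AR1 M \<theta> X \<epsilon>"
    and "\<And>n \<omega>. n \<ge> 1 \<Longrightarrow>
      S n \<omega> = (1 / real n) *\<^sub>R (\<Sum>k=1..n. X k \<omega>, \<Sum>k=1..n. (X k \<omega>)\<^sup>2)"
  shows "satisfies_LDP M S (J_S \<theta>) \<and> good_rate_function (J_S \<theta>)"
proof -
  have \<theta>: "\<bar>\<theta>\<bar> < 1"
    using assms(1) by auto
  show ?thesis
    unfolding satisfies_LDP_def
    using S_measurable[OF assms(2,3)] J_S_nonneg[OF \<theta>] J_S_lower_semicontinuous[OF \<theta>]
      LDP_upper_bound[OF assms(2,3)] LDP_lower_bound[OF assms(2,3)] J_S_good[OF \<theta>]
    by blast
qed

end
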